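(* Given any weak composition $\mathbf{a}=(a_1,\ldots,a_n)$ and any positive integer $k\le n$, there exists a weight-preserving bijection $$\mathrm{KD}(\mathbf{a})\times\mathrm{KD}(\mathbf{e}_k)\ \xrightarrow{\ \sim\ }\ \bigcup_{\substack{\mathbf{b}\preceq\mathbf{a}\\ 1\le j\le k}}\mathrm{KD}(\mathbf{b}+\mathbf{e}_j),$$ where the addition of weak compositions on the right is coordinatewise.
   Context: Fix a positive integer $n$. A weak composition is a sequence $\mathbf{a}=(a_1,\ldots,a_n)$ of nonnegative integers; $\mathbf{e}_k$ is the weak composition with a single nonzero part, equal to $1$, in position $k$. A diagram is a finite set of unit cells in the first quadrant; the cell in column $c$ and row $r$ ($c,r\ge1$, columns numbered left to right, rows bottom to top) is denoted $(c,r)$. The key diagram of $\mathbf{a}$ has cells $(c,r)$ with $1\le c\le a_r$. A Kohnert move on a diagram selects the rightmost cell of some row and moves it down within its column to the first unoccupied position below (in a row $\ge1$), if one exists, jumping over other cells as needed. $\mathrm{KD}(\mathbf{a})$ is the set of diagrams obtainable from the key diagram of $\mathbf{a}$ by a (possibly empty) sequence of Kohnert moves. For a diagram $T$, $\mathbf{wt}(T)$ is the weak composition whose $i$th part is the number of cells in row $i$; the weight of a pair is $\mathbf{wt}(S,T)=\mathbf{wt}(S)+\mathbf{wt}(T)$. A left swap on $\mathbf{a}$ exchanges two parts $a_i<a_j$ with $i<j$. The left swap order is the reflexive transitive closure of the relations $\mathbf{b}\preceq\mathbf{a}$ whenever $\mathbf{b}$ is a left swap of $\mathbf{a}$. *)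

theory Defs
  imports Main "HOL-Library.Function_Algebras"
begin

text \<open>
  A weak composition \<open>(a\<^sub>1, \<dots>, a\<^sub>n)\<close> is encoded as a function on \<open>nat\<close> vanishing outside
  \<open>{1..n}\<close>, so that equality of functions is equality of sequences. Addition is the
  pointwise one from \<^theory>\<open>HOL-Library.Function_Algebras\<close>.
\<close>

definition weak_composition :: "nat \<Rightarrow> (nat \<Rightarrow> nat) \<Rightarrow> bool" where
  "weak_composition n a \<longleftrightarrow> (\<forall>i. i \<notin> {1..n} \<longrightarrow> a i = 0)"

definition unit_comp :: "nat \<Rightarrow> nat \<Rightarrow> nat" where
  "unit_comp k = (\<lambda>i. if i = k then 1 else 0)"

text \<open>
  The pair \<open>(c, r)\<close> is the cell in column \<open>c\<close> and row \<open>r\<close>. Finiteness and positivity of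
  coordinates are not built into the type: key diagrams of weak compositions have both
  properties, and Kohnert moves preserve them.
\<close>

type_synonym diagram = "(nat \<times> nat) set"

definition key_diagram :: "(nat \<Rightarrow> nat) \<Rightarrow> diagram" where
  "key_diagram a = {(c, r). 1 \<le> r \<and> 1 \<le> c \<and> c \<le> a r}"

definition kohnert_move :: "diagram \<Rightarrow> diagram \<Rightarrow> bool" where
  "kohnert_move D D' \<longleftrightarrow>
     (\<exists>c r s. (c, r) \<in> D \<and> (\<forall>c'. (c', r) \<in> D \<longrightarrow> c' \<le> c) \<and>
              1 \<le> s \<and> s < r \<and> (c, s) \<notin> D \<and> (\<forall>t. s < t \<and> t < r \<longrightarrow> (c, t) \<in> D) \<and>
              D' = insert (c, s) (D - {(c, r)}))"

definition KD :: "(nat \<Rightarrow> nat) \<Rightarrow> diagram set" where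
  "KD a = {D. kohnert_move\<^sup>*\<^sup>* (key_diagram a) D}"

definition wt :: "diagram \<Rightarrow> nat \<Rightarrow> nat" where
  "wt T = (\<lambda>r. card {c. (c, r) \<in> T})"

text \<open>\<open>left_swap n b a\<close>: \<open>b\<close> is a left swap of \<open>a\<close>.\<close>

definition left_swap :: "nat \<Rightarrow> (nat \<Rightarrow> nat) \<Rightarrow> (nat \<Rightarrow> nat) \<Rightarrow> bool" where
  "left_swap n b a \<longleftrightarrow>
     (\<exists>i j. 1 \<le> i \<and> i < j \<and> j \<le> n \<and> a i < a j \<and> b = a(i := a j, j := a i))"

definition left_swap_le :: "nat \<Rightarrow> (nat \<Rightarrow> nat) \<Rightarrow> (nat \<Rightarrow> nat) \<Rightarrow> bool" where
  "left_swap_le n = (left_swap n)\<^sup>*\<^sup>*"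

end

theory Submission
  imports Defs "HOL-Computational_Algebra.Polynomial" "HOL-Combinatorics.Transposition"
begin

text \<open>
  All sets of diagrams involved are finite, so it suffices to compare generating functions.
  Reading a diagram column by column and pushing every column leftwards through its predecessors
  by a greedy matching attaches a composition \<open>\<theta>(T)\<close> to a diagram \<open>T\<close>, and \<open>T \<in> KD(a)\<close> holds iff
  \<open>\<theta>(T) \<preceq> a\<close>. The matching behaves well enough under the transposition of rows \<open>i\<close> and \<open>i + 1\<close>
  to yield the Demazure relation: passing from a set \<open>L\<close> of compositions to
  \<open>{d. d or s\<^sub>i d, whichever is decreasing at i, lies in L}\<close> applies the isobaric divided difference
  \<open>\<pi>\<^sub>i\<close> to the generating function of \<open>{T. \<theta>(T) \<in> L}\<close>.

  Let \<open>L(a, k)\<close> be the set of all \<open>d \<preceq> b + e\<^sub>j\<close> with \<open>b \<preceq> a\<close> and \<open>j \<le> k\<close>; it is cut out by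
  inequalities between counts of large parts. The identity
  \<open>(x\<^sub>1 + \<dots> + x\<^sub>k) \<Sum>{x\<^sup>T | \<theta>(T) \<preceq> a} = \<Sum>{x\<^sup>T | \<theta>(T) \<in> L(a, k)}\<close> is clear for weakly decreasing \<open>a\<close>.
  If \<open>a\<^sub>i > a\<^bsub>i+1\<^esub>\<close>, it passes from \<open>a\<close> to \<open>s\<^sub>i a\<close>: for \<open>k \<noteq> i\<close> because \<open>x\<^sub>1 + \<dots> + x\<^sub>k\<close> commutes
  with \<open>\<pi>\<^sub>i\<close>, and for \<open>k = i\<close> because of \<open>x\<^bsub>i+1\<^esub> \<pi>\<^sub>i f = \<pi>\<^sub>i (x\<^sub>i f) - x\<^sub>i f\<close> together with a linear
  relation between the indicator functions of \<open>L(a, i - 1)\<close>, \<open>L(a, i)\<close>, of the set arising from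
  \<open>L(a, i)\<close> under \<open>\<pi>\<^sub>i\<close>, and of \<open>L(s\<^sub>i a, k)\<close> for \<open>|k - i| \<le> 1\<close>.
\<close>

subsection \<open>Counting and greedy matching of columns\<close>

text \<open>An indicator sum instead of a cardinality, so that it unfolds one row at a time and
  needs no finiteness.\<close>

definition count_below :: "nat set \<Rightarrow> nat \<Rightarrow> nat" where
  "count_below Y t = (\<Sum>i<t. of_bool (i \<in> Y))"

lemma count_below_0 [simp]: "count_below Y 0 = 0"
  and count_below_Suc: "count_below Y (Suc t) = count_below Y t + of_bool (t \<in> Y)"
  by (simp_all add: count_below_def)

lemma count_below_empty [simp]: "count_below {} t = 0"
  by (simp add: count_below_def)

lemma count_below_subset: "X \<subseteq> Y \<Longrightarrow> count_below X t \<le> count_below Y t"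
  by (induction t) (auto simp: count_below_Suc)

lemma count_below_mono: "s \<le> t \<Longrightarrow> count_below Y s \<le> count_below Y t"
  by (induction rule: dec_induct) (auto simp: count_below_Suc)

lemma count_below_cong: "(\<And>i. i < t \<Longrightarrow> i \<in> X \<longleftrightarrow> i \<in> Y) \<Longrightarrow> count_below X t = count_below Y t"
  by (induction t) (auto simp: count_below_Suc)

lemma count_below_const:
  assumes "Y \<subseteq> {1..n}" "Suc n \<le> t"
  shows "count_below Y t = count_below Y (Suc n)"
  using assms(2) by (induction rule: dec_induct) (use assms(1) in \<open>auto simp: count_below_Suc\<close>)

lemma count_below_less_ex:
  assumes "count_below Y s < count_below Y t"
  shows "\<exists>i. s \<le> i \<and> i < t \<and> i \<in> Y"
proof (rule ccontr)
  assume nt: "\<not> ?thesis"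
  have *: "i \<notin> Y" if "s \<le> i" "i < t" for i using nt \<open>s \<le> i\<close> \<open>i < t\<close> by blast
  have "s \<le> t" using assms count_below_mono[of t s Y] by linarith
  then have "count_below Y t = count_below Y s"
    using * by (induction rule: dec_induct) (auto simp: count_below_Suc)
  then show False using assms by simp
qed

text \<open>
  Rows are scanned upwards; an element of \<open>Y\<close> waits until it meets a free slot in \<open>C\<close>. The number
  waiting just below row \<open>t\<close> is \<open>carry C Y t\<close>: the truncated subtraction leaves a slot empty when
  nobody waits.
\<close>

primrec carry :: "nat set \<Rightarrow> nat set \<Rightarrow> nat \<Rightarrow> nat" where
  "carry C Y 0 = 0"
| "carry C Y (Suc t) = carry C Y t + of_bool (t \<in> Y) - of_bool (t \<in> C)"

lemmas carry_Suc = carry.simps(2)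
declare carry_Suc [simp del]

definition match_up :: "nat set \<Rightarrow> nat set \<Rightarrow> nat set" where
  "match_up C Y = {t \<in> C. 0 < carry C Y t + of_bool (t \<in> Y)}"

lemma match_up_subset: "match_up C Y \<subseteq> C"
  by (auto simp: match_up_def)

text \<open>Conservation: each element of \<open>Y\<close> below \<open>t\<close> has either been
  given a slot or is still waiting.\<close>

lemma count_below_match_up: "count_below (match_up C Y) t + carry C Y t = count_below Y t"
  by (induction t) (auto simp: match_up_def count_below_Suc carry_Suc)

text \<open>A recursion without \<open>carry\<close>: the number of filled slots grows with
  \<open>C\<close> until the number of candidates caps it. Monotonicity in \<open>Y\<close> and the
  effect of moving a slot are read off from it.\<close>

lemma count_below_match_up_Suc:
  "count_below (match_up C Y) (Suc t) = min (count_below (match_up C Y) t + of_bool (t \<in> C))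
      (count_below Y (Suc t))"
  using count_below_match_up[of C Y t] by (auto simp: match_up_def count_below_Suc)

lemma count_below_match_up_le: "count_below (match_up C Y) t \<le> count_below Y t"
  using count_below_match_up[of C Y t] by simp

lemma carry_mono: "X \<subseteq> Y \<Longrightarrow> carry C X t \<le> carry C Y t"
  by (induction t) (auto simp: of_bool_def carry_Suc)

lemma match_up_mono:
  assumes "X \<subseteq> Y"
  shows "match_up C X \<subseteq> match_up C Y"
proof
  fix t assume "t \<in> match_up C X"
  then show "t \<in> match_up C Y"
    using carry_mono[OF assms, of C t] assms
        by (auto simp: match_up_def of_bool_def split: if_splits)
qed

lemma carry_subset: "Y \<subseteq> C \<Longrightarrow> carry C Y t = 0"
  by (induction t) (auto simp: carry_Suc)

lemma match_up_id: "Y \<subseteq> C \<Longrightarrow> match_up C Y = Y"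
  by (auto simp: match_up_def carry_subset of_bool_def)

lemma carry_cong:
  "(\<And>j. j < t \<Longrightarrow> j \<in> X \<longleftrightarrow> j \<in> Y) \<Longrightarrow> (\<And>j. j < t \<Longrightarrow> j \<in> C \<longleftrightarrow> j \<in> D) \<Longrightarrow> carry C X t = carry D Y t"
  by (induction t) (auto simp: carry_Suc)

lemma carry_cong_from:
  assumes "carry C X s = carry D Y s" "s \<le> t"
    and "\<And>j. s \<le> j \<Longrightarrow> j < t \<Longrightarrow> j \<in> X \<longleftrightarrow> j \<in> Y" "\<And>j. s \<le> j \<Longrightarrow> j < t \<Longrightarrow> j \<in> C \<longleftrightarrow> j \<in> D"
  shows "carry C X t = carry D Y t"
  using assms(2,1,3,4) by (induction rule: dec_induct) (auto simp: carry_Suc)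

lemma match_up_empty [simp]: "match_up C {} = {}"
  by (simp add: match_up_id)

lemma count_below_match_up_mono:
  assumes "\<And>t. count_below X t \<le> count_below Y t"
  shows "count_below (match_up C X) t \<le> count_below (match_up C Y) t"
proof (induction t)
  case (Suc t)
  then show ?case using assms[of "Suc t"] unfolding count_below_match_up_Suc by linarith
qed simp

text \<open>The effect of a Kohnert move in the first column: up to \<open>s\<close> nothing is
  lost, between \<open>s\<close> and \<open>r\<close> the new matching is ahead by one or has
  exhausted \<open>Y\<close>, and this lead pays for the slot lost at \<open>r\<close>.\<close>

lemma count_below_match_up_move:
  assumes "r \<notin> Y" "s < r" "s \<notin> C" "\<And>u. s < u \<Longrightarrow> u < r \<Longrightarrow> u \<in> C"
  shows "count_below (match_up C Y) t \<le> count_below (match_up (insert s (C - {r})) Y) t"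
proof -
  let ?D = "insert s (C - {r})"
  have low: "count_below (match_up C Y) u \<le> count_below (match_up ?D Y) u" if "u \<le> s" for u
    using that
  proof (induction u)
    case (Suc u)
    then show ?case using assms(2) unfolding count_below_match_up_Suc
        by (auto simp: of_bool_def count_below_Suc)
  qed simp
  have mid: "min (count_below (match_up C Y) u + 1) (count_below Y u)
      \<le> count_below (match_up ?D Y) u" if "Suc s \<le> u" "u \<le> r" for u
    using that
  proof (induction rule: dec_induct)
    case base
    then show ?case using assms(2,3) low[of s]
        unfolding count_below_match_up_Suc by (auto simp: min_def count_below_Suc)
  next
    case (step u)
    then have "u \<in> C" "u \<noteq> r" "u \<noteq> s" using assms(4) by auto
    with step show ?case unfolding count_below_match_up_Suc[of C] count_below_match_up_Suc[of ?D]
        by (auto simp: min_def count_below_Suc split: if_splits)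
  qed
  have high: "count_below (match_up C Y) u \<le> count_below (match_up ?D Y) u" if "Suc r \<le> u" for u
    using that
  proof (induction rule: dec_induct)
    case base
    \<comment> \<open>Since \<open>r \<notin> Y\<close>, there are as many candidates below
      \<open>r\<close> as below \<open>Suc r\<close>, so filling slot \<open>r\<close> cannot exceed
      the bound from \<open>mid\<close>.\<close>
    have "count_below (match_up C Y) (Suc r)
        \<le> min (count_below (match_up C Y) r + 1) (count_below Y r)"
      using assms(1) unfolding count_below_match_up_Suc by (auto simp: min_def count_below_Suc)
    also have "\<dots> \<le> count_below (match_up ?D Y) r" using mid[of r] assms(2) by simp
    finally show ?case by (simp add: count_below_Suc)
  next
    case (step u)
    then show ?case using assms(2) unfolding count_below_match_up_Suc[of C]
        count_below_match_up_Suc[of ?D] by (auto simp: min_def)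
  qed
  have mid': "count_below (match_up C Y) u \<le> count_below (match_up ?D Y) u"
      if "Suc s \<le> u" "u \<le> r" for u
    using mid[OF that] count_below_match_up_le[of C Y u] by linarith
  show ?thesis using low mid' high by (metis not_less_eq_eq)
qed

section \<open>Superlevel sets of compositions and pushing them through a column\<close>

definition level :: "(nat \<Rightarrow> nat) \<Rightarrow> nat \<Rightarrow> nat set" where
  "level w m = {i. m \<le> w i}"

lemma level_antimono: "m \<le> m' \<Longrightarrow> level w m' \<subseteq> level w m"
  by (auto simp: level_def)

lemma level_eqI:
  assumes "\<And>m. level v (Suc m) = level w (Suc m)"
  shows "v = w"
proof
  fix r
  have "m < v r \<longleftrightarrow> m < w r" for m
    using assms[of m] by (auto simp: level_def Suc_le_eq)
  then show "v r = w r" by (metis less_irrefl linorder_neqE_nat)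
qed

lemma level_wc: "weak_composition n w \<Longrightarrow> 1 \<le> m \<Longrightarrow> level w m \<subseteq> {1..n}"
  by (force simp: weak_composition_def level_def)

lemma wc_bounded:
  assumes "weak_composition n w"
  obtains M where "\<And>i. w i \<le> M"
proof
  fix i
  show "w i \<le> (\<Sum>j\<in>{1..n}. w j)"
    using assms by (cases "i \<in> {1..n}") (auto simp: weak_composition_def intro: member_le_sum)
qed

text \<open>
  Every part of \<open>w\<close> moves weakly up to a row in \<open>C\<close>, longer parts choosing first and each taking the
  lowest free row; the parts \<open>\<ge> m\<close> then occupy \<open>match_up C (level w m)\<close>.
\<close>

definition push_col :: "nat set \<Rightarrow> (nat \<Rightarrow> nat) \<Rightarrow> nat \<Rightarrow> nat" where
  "push_col C w r = (if r \<in> C then Suc (card {m. 1 \<le> m \<and> r \<in> match_up C (level w m)}) else 0)"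

lemma level_push_col_1 [simp]: "level (push_col C w) (Suc 0) = C"
  by (auto simp: level_def push_col_def)

text \<open>The matched sets are nested in \<open>m\<close>, so the \<open>m\<close> that reach a
  given row form an interval \<open>{1..K}\<close>, and the cardinality in \<open>push_col\<close>
  is its upper end. The bound on the parts keeps it finite.\<close>

lemma level_push_col_Suc:
  assumes "weak_composition n w" "1 \<le> m"
  shows "level (push_col C w) (Suc m) = match_up C (level w m)"
proof -
  obtain M where M: "\<And>i. w i \<le> M" using wc_bounded[OF assms(1)] by blast
  have "m \<le> card {m. 1 \<le> m \<and> r \<in> match_up C (level w m)} \<longleftrightarrow> r \<in> match_up C (level w m)" for r
  proof -
    let ?S = "{m. 1 \<le> m \<and> r \<in> match_up C (level w m)}"
    have sub: "?S \<subseteq> {1..M}"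
    proof
      fix m assume "m \<in> ?S"
      then have "1 \<le> m" "level w m \<noteq> {}" by auto
      then show "m \<in> {1..M}" using M by (auto simp: level_def intro: order.trans)
    qed
    then have fin: "finite ?S" by (rule finite_subset) simp
    have dc: "m' \<in> ?S" if "m \<in> ?S" "1 \<le> m'" "m' \<le> m" for m m'
      using that match_up_mono[OF level_antimono[of m' m w], of C] by auto
    obtain K where K: "?S = {1..K}"
    proof (cases "?S = {}")
      case True
      then show ?thesis using that[of 0] by simp
    next
      case False
      have "?S = {1..Max ?S}"
        using dc[OF Max_in[OF fin False]] Max_ge[OF fin] by fastforce
      then show ?thesis using that by blast
    qed
    then have "m \<in> ?S \<longleftrightarrow> m \<in> {1..card ?S}" by (simp only:) simp
    then show ?thesis using assms(2) by simp
  qed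
  then show ?thesis using match_up_subset[of C] by (auto simp: level_def push_col_def)
qed

lemma push_col_wc: "C \<subseteq> {1..n} \<Longrightarrow> weak_composition n (push_col C w)"
  by (auto simp: weak_composition_def push_col_def)

text \<open>On weak compositions this is the left swap order expressed by counts: the lower one has
  its large parts earlier. The equality at \<open>Suc n\<close> says that both have the same parts
  up to order.\<close>

definition below :: "nat \<Rightarrow> (nat \<Rightarrow> nat) \<Rightarrow> (nat \<Rightarrow> nat) \<Rightarrow> bool" where
  "below n b a \<longleftrightarrow> (\<forall>m\<ge>1. (\<forall>t. count_below (level a m) t \<le> count_below (level b m) t) \<and>
                     count_below (level a m) (Suc n) = count_below (level b m) (Suc n))"

lemma below_refl [simp]: "below n a a"
  by (simp add: below_def)

lemma below_trans: "below n a b \<Longrightarrow> below n b c \<Longrightarrow> below n a c"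
  unfolding below_def by (metis order.trans)

text \<open>This is \<theta>(T). The head of the list is column 1, so the recursion starts at the
  rightmost column.\<close>

primrec thread_comp :: "nat set list \<Rightarrow> nat \<Rightarrow> nat" where
  "thread_comp [] = (\<lambda>_. 0)"
| "thread_comp (C # T) = push_col C (thread_comp T)"

text \<open>The last condition says that every thread arriving from the right finds a slot in
  \<open>C\<close>. Level 1 suffices, higher levels being subsets.\<close>

primrec valid_columns :: "nat \<Rightarrow> nat set list \<Rightarrow> bool" where
  "valid_columns n [] = True"
| "valid_columns n (C # T) = (C \<subseteq> {1..n} \<and> valid_columns n T
    \<and> carry C (level (thread_comp T) 1) (Suc n) = 0)"

lemma thread_comp_wc: "valid_columns n T \<Longrightarrow> weak_composition n (thread_comp T)"
  by (cases T) (auto simp: weak_composition_def[of n "\<lambda>_. 0"] push_col_wc)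

text \<open>By conservation: \<open>Y\<close>, sitting lower, fills at least as many slots as
  \<open>X\<close>, and \<open>X\<close> already fills as many as it has elements.\<close>

lemma dom_mono:
  assumes "\<And>t. count_below X t \<le> count_below Y t" "count_below X (Suc n) = count_below Y (Suc n)"
      "carry C X (Suc n) = 0"
  shows "carry C Y (Suc n) = 0"
  using count_below_match_up_mono[OF assms(1), where t = "Suc n" and C = C] assms(2,3)
    count_below_match_up[of C X "Suc n"] count_below_match_up[of C Y "Suc n"] by linarith

lemma carry_le_zero: "X \<subseteq> Y \<Longrightarrow> carry C Y t = 0 \<Longrightarrow> carry C X t = 0"
  using carry_mono by (metis le_zero_eq)

lemma count_below_match_up_total: "carry C Y t = 0 \<Longrightarrow> count_below (match_up C Y) t = count_below Y t"
  using count_below_match_up[of C Y t] by simp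

text \<open>Pushing through a fixed column is monotone; this carries a move in a later column over
  to the whole diagram.\<close>

lemma below_push_col_cong:
  assumes "below n v w" "weak_composition n v" "weak_composition n w"
    and "carry C (level w 1) (Suc n) = 0"
  shows "below n (push_col C v) (push_col C w)" and "carry C (level v 1) (Suc n) = 0"
proof -
  show c: "carry C (level v 1) (Suc n) = 0"
    using assms(1,4) dom_mono[of "level w 1" "level v 1"] by (simp add: below_def)
  show "below n (push_col C v) (push_col C w)"
    unfolding below_def
  proof (intro allI impI)
    fix m :: nat assume m: "1 \<le> m"
    show "(\<forall>t. count_below (level (push_col C w) m) t \<le> count_below (level (push_col C v) m) t) \<and>
        count_below (level (push_col C w) m) (Suc n) = count_below (level (push_col C v) m) (Suc n)"
    proof (cases "m = 1")
      case False
      then obtain k where k: "m = Suc k" "1 \<le> k" using m by (cases m) auto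
      have "carry C (level w k) (Suc n) = 0" "carry C (level v k) (Suc n) = 0"
        using carry_le_zero[OF level_antimono[OF k(2)]] assms(4) c by auto
      then show ?thesis
        using assms(1) k unfolding k(1) level_push_col_Suc[OF assms(2) k(2)]
            level_push_col_Suc[OF assms(3) k(2)]
        by (simp add: below_def count_below_match_up_total count_below_match_up_mono)
    qed auto
  qed
qed

subsection \<open>Kohnert moves on columns\<close>

definition cons_col :: "nat set \<Rightarrow> diagram \<Rightarrow> diagram" where
  "cons_col C D = {(c, r). (c = 1 \<and> r \<in> C) \<or> (2 \<le> c \<and> (c - 1, r) \<in> D)}"

primrec diagram_of :: "nat set list \<Rightarrow> diagram" where
  "diagram_of [] = {}"
| "diagram_of (C # T) = cons_col C (diagram_of T)"

text \<open>\<open>M\<close> only has to bound the parts; surplus columns are empty. A common length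
  of the lists makes \<open>diagram_of\<close> injective.\<close>

primrec key_columns :: "nat \<Rightarrow> (nat \<Rightarrow> nat) \<Rightarrow> nat set list" where
  "key_columns 0 a = []"
| "key_columns (Suc M) a = level a 1 # key_columns M (\<lambda>r. a r - 1)"

lemma mem_cons_col [simp]:
  "(Suc 0, r) \<in> cons_col C D \<longleftrightarrow> r \<in> C"
  "(0, r) \<notin> cons_col C D"
  "(Suc (Suc c), r) \<in> cons_col C D \<longleftrightarrow> (Suc c, r) \<in> D"
  by (auto simp: cons_col_def)

lemma diagram_of_pos: "(c, r) \<in> diagram_of T \<Longrightarrow> 1 \<le> c"
  by (cases T) (auto simp: cons_col_def)

lemma length_key_columns [simp]: "length (key_columns M a) = M"
  by (induction M arbitrary: a) auto

lemma level_minus_1: "1 \<le> m \<Longrightarrow> level (\<lambda>r. a r - 1) m = level a (Suc m)"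
  by (auto simp: level_def)

lemma wc_minus_1: "weak_composition n a \<Longrightarrow> weak_composition n (\<lambda>r. a r - 1)"
  by (simp add: weak_composition_def)

lemma wc_0: "weak_composition n a \<Longrightarrow> a 0 = 0"
  by (simp add: weak_composition_def)

lemma key_diagram_cons:
  assumes "a 0 = 0"
  shows "key_diagram a = cons_col (level a 1) (key_diagram (\<lambda>r. a r - 1))"
proof -
  have "1 \<le> r" if "1 \<le> a r" for r using assms that by (cases r) auto
  then show ?thesis by (fastforce simp: cons_col_def key_diagram_def level_def)
qed

lemma diagram_of_key_columns:
  assumes "a 0 = 0" "\<And>r. a r \<le> M"
  shows "diagram_of (key_columns M a) = key_diagram a"
  using assms
proof (induction M arbitrary: a)
  case (Suc M)
  have "diagram_of (key_columns M (\<lambda>r. a r - 1)) = key_diagram (\<lambda>r. a r - 1)"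
    by (rule Suc.IH) (use Suc.prems in \<open>auto simp: le_diff_conv\<close>)
  then show ?case using key_diagram_cons[of a] Suc.prems by simp
qed (auto simp: key_diagram_def)

text \<open>In a key diagram each column contains the next one, so the matching moves
  nothing.\<close>

lemma thread_comp_key_columns:
  assumes "weak_composition n a" "\<And>r. a r \<le> M"
  shows "thread_comp (key_columns M a) = a \<and> valid_columns n (key_columns M a)"
  using assms
proof (induction M arbitrary: a)
  case (Suc M)
  let ?w = "\<lambda>r. a r - 1"
  have IH: "thread_comp (key_columns M ?w) = ?w" "valid_columns n (key_columns M ?w)"
    using Suc.IH[of ?w] Suc.prems wc_minus_1[OF Suc.prems(1)] by (simp_all add: le_diff_conv)
  have sub: "level ?w m \<subseteq> level a 1" if "1 \<le> m" for m
    unfolding level_minus_1[OF that] by (rule level_antimono) simp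
  have "push_col (level a 1) ?w = a"
  proof (rule level_eqI)
    fix m
    show "level (push_col (level a 1) ?w) (Suc m) = level a (Suc m)"
    proof (cases m)
      case (Suc k)
      then have "1 \<le> m" by simp
      then show ?thesis
        using level_push_col_Suc[OF wc_minus_1[OF Suc.prems(1)], of m "level a 1"] sub[of m]
          level_minus_1[of m a] by (simp add: match_up_id)
    qed simp
  qed
  then show ?case
    using IH level_wc[OF Suc.prems(1), of 1] carry_subset[OF sub[of 1]] by simp
qed (auto simp: weak_composition_def)

lemma count_below_move:
  assumes "r \<in> C" "s < r" "s \<notin> C"
  shows "count_below (insert s (C - {r})) t = count_below C t + of_bool (s < t \<and> t \<le> r)"
proof (induction t)
  case (Suc t)
  then show ?case
    using assms by (cases "t = s"; cases "t = r") (auto simp: count_below_Suc less_Suc_eq Suc_le_eq)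
qed simp

lemma kohnert_moveI:
  assumes "(c, r) \<in> D" "\<And>c'. (c', r) \<in> D \<Longrightarrow> c' \<le> c" "1 \<le> s" "s < r" "(c, s) \<notin> D"
    "\<And>t. s < t \<Longrightarrow> t < r \<Longrightarrow> (c, t) \<in> D"
  shows "kohnert_move D (insert (c, s) (D - {(c, r)}))"
  unfolding kohnert_move_def using assms by blast

lemma kohnert_move_cons_col:
  assumes "kohnert_move D D'" "\<And>c r. (c, r) \<in> D \<Longrightarrow> 1 \<le> c"
  shows "kohnert_move (cons_col C D) (cons_col C D')"
proof -
  obtain c r s where *: "(c, r) \<in> D" "\<forall>c'. (c', r) \<in> D \<longrightarrow> c' \<le> c" "1 \<le> s" "s < r" "(c, s) \<notin> D"
    "\<forall>t. s < t \<and> t < r \<longrightarrow> (c, t) \<in> D" "D' = insert (c, s) (D - {(c, r)})"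
    using assms(1) unfolding kohnert_move_def by blast
  obtain d where c: "c = Suc d" using assms(2)[OF *(1)] by (cases c) auto
  have "kohnert_move (cons_col C D) (insert (Suc c, s) (cons_col C D - {(Suc c, r)}))"
  proof (rule kohnert_moveI)
    fix c' assume "(c', r) \<in> cons_col C D"
    then show "c' \<le> Suc c" using *(2) by (auto simp: cons_col_def le_diff_conv)
  qed (use *(1,3-6) in \<open>simp_all add: c\<close>)
  moreover have "cons_col C D' = insert (Suc c, s) (cons_col C D - {(Suc c, r)})"
    unfolding *(7) c by (auto simp: cons_col_def)
  ultimately show ?thesis by simp
qed

lemma kohnert_move_pos:
  "kohnert_move D D' \<Longrightarrow> (\<And>c r. (c, r) \<in> D \<Longrightarrow> 1 \<le> c) \<Longrightarrow> (c, r) \<in> D' \<Longrightarrow> 1 \<le> c"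
  by (auto simp: kohnert_move_def)

lemma kohnert_moves_cons_col:
  assumes "kohnert_move\<^sup>*\<^sup>* D D'" "\<And>c r. (c, r) \<in> D \<Longrightarrow> 1 \<le> c"
  shows "kohnert_move\<^sup>*\<^sup>* (cons_col C D) (cons_col C D') \<and> (\<forall>c r. (c, r) \<in> D' \<longrightarrow> 1 \<le> c)"
  using assms(1)
proof induction
  case (step E E')
  then show ?case
    using kohnert_move_cons_col[of E E' C] kohnert_move_pos[of E E']
    by (metis rtranclp.rtrancl_into_rtrancl)
qed (use assms(2) in auto)

lemma level_thread_comp_1: "r \<in> level (thread_comp T) 1 \<Longrightarrow> (1, r) \<in> diagram_of T"
  by (cases T) (auto simp: level_def push_col_def split: if_splits)

text \<open>A Kohnert move lowers \<theta>. In the first column this is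
  \<open>count_below_match_up_move\<close>; further right it is the induction hypothesis followed by
  \<open>below_push_col_cong\<close>.\<close>

lemma kohnert_move_diagram_of:
  assumes "valid_columns n T" "kohnert_move (diagram_of T) D'"
  shows "\<exists>T'. D' = diagram_of T' \<and> length T'
      = length T \<and> valid_columns n T' \<and> below n (thread_comp T') (thread_comp T)"
  using assms
proof (induction T arbitrary: D')
  case Nil
  then show ?case by (simp add: kohnert_move_def)
next
  case (Cons C T)
  let ?w = "thread_comp T"
  have v: "C \<subseteq> {1..n}" "valid_columns n T" "carry C (level ?w 1) (Suc n) = 0"
      using Cons.prems by auto
  note wc = thread_comp_wc[OF v(2)]
  obtain c r s where *: "(c, r) \<in> diagram_of (C # T)" "\<forall>c'. (c', r) \<in> diagram_of (C # T) \<longrightarrow> c' \<le> c"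
      "1 \<le> s" "s < r"
    "(c, s) \<notin> diagram_of (C # T)" "\<forall>t. s < t \<and> t < r \<longrightarrow> (c, t) \<in> diagram_of (C # T)"
    "D' = insert (c, s) (diagram_of (C # T) - {(c, r)})"
    using Cons.prems(2) unfolding kohnert_move_def by blast
  show ?case
  proof (cases "c = 1")
    case True
    let ?C = "insert s (C - {r})"
    have C: "r \<in> C" "s \<notin> C" "\<And>t. s < t \<Longrightarrow> t < r \<Longrightarrow> t \<in> C" using * True by auto
    \<comment> \<open>The moved cell is the rightmost of its row, so no thread arrives at row
      \<open>r\<close> from the right.\<close>
    have r: "r \<notin> level ?w m" if "1 \<le> m" for m
    proof
      assume "r \<in> level ?w m"
      then have "r \<in> level ?w 1" using level_antimono[OF that] by blast
      then have "(Suc (Suc 0), r) \<in> diagram_of (C # T)" using level_thread_comp_1[of r T] by simp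
      then show False using *(2) True by fastforce
    qed
    have sub: "?C \<subseteq> {1..n}" using v(1) C(1) *(3,4) by auto
    have mv: "count_below (match_up C (level ?w m)) t \<le> count_below (match_up ?C (level ?w m)) t"
        if "1 \<le> m" for m t
      by (rule count_below_match_up_move) (use r[OF that] *(4) C in auto)
    have z: "carry C (level ?w m) (Suc n) = 0" "carry ?C (level ?w m) (Suc n) = 0" if "1 \<le> m" for m
    proof -
      show 1: "carry C (level ?w m) (Suc n) = 0"
        using carry_le_zero[OF level_antimono[OF that] v(3)] .
      show "carry ?C (level ?w m) (Suc n) = 0"
        using mv[OF that, of "Suc n"] 1 count_below_match_up[of C "level ?w m" "Suc n"]
            count_below_match_up[of ?C "level ?w m" "Suc n"]
        by linarith
    qed
    have "below n (push_col ?C ?w) (push_col C ?w)"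
      unfolding below_def
    proof (intro allI impI)
      fix m :: nat assume m: "1 \<le> m"
      show "(\<forall>t. count_below (level (push_col C ?w) m) t
          \<le> count_below (level (push_col ?C ?w) m) t) \<and>
        count_below (level (push_col C ?w) m) (Suc n)
            = count_below (level (push_col ?C ?w) m) (Suc n)"
      proof (cases "m = 1")
        case True
        have "r < Suc n" using C(1) v(1) by auto
        then show ?thesis unfolding True using count_below_move[OF C(1) *(4) C(2)] by simp
      next
        case False
        then obtain k where k: "m = Suc k" "1 \<le> k" using m by (cases m) auto
        show ?thesis
          unfolding k(1) level_push_col_Suc[OF wc k(2)]
          using mv[OF k(2)] count_below_match_up_total[OF z(1)[OF k(2)]]
              count_below_match_up_total[OF z(2)[OF k(2)]] by simp
      qed
    qed
    moreover have "D' = diagram_of (?C # T)"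
      unfolding *(7) True by (auto simp: cons_col_def)
    ultimately show ?thesis
      using v sub z(2)[of 1] by (intro exI[of _ "?C # T"]) auto
  next
    case False
    then obtain d where c: "c = Suc (Suc d)"
        using diagram_of_pos[OF *(1)] by (cases c; cases "c - 1") auto
    define D1 where "D1 = insert (Suc d, s) (diagram_of T - {(Suc d, r)})"
    have le: "c' \<le> Suc d" if "(c', r) \<in> diagram_of T" for c'
    proof -
      have "(Suc c', r) \<in> diagram_of (C # T)"
          using that diagram_of_pos[OF that] by (simp add: cons_col_def)
      then show ?thesis using *(2) c by auto
    qed
    have "kohnert_move (diagram_of T) D1"
      unfolding D1_def by (rule kohnert_moveI) (use *(1,3-6) le in \<open>simp_all add: c\<close>)
    then obtain T' where T': "D1 = diagram_of T'" "length T' = length T" "valid_columns n T'"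
        "below n (thread_comp T') (thread_comp T)"
      using Cons.IH[OF v(2)] by blast
    have "D' = diagram_of (C # T')"
      unfolding *(7) c by (auto simp: cons_col_def T'(1)[symmetric] D1_def)
    then show ?thesis
      using T' v below_push_col_cong[OF T'(4) thread_comp_wc[OF T'(3)] wc v(3)]
      by (intro exI[of _ "C # T'"]) auto
  qed
qed

lemma KD_imp_thread_comp_below:
  assumes "weak_composition n a" "\<And>r. a r \<le> M" "D \<in> KD a"
  shows "\<exists>T. D = diagram_of T \<and> length T = M \<and> valid_columns n T \<and> below n (thread_comp T) a"
proof -
  have "kohnert_move\<^sup>*\<^sup>* (key_diagram a) D" using assms(3) by (simp add: KD_def)
  then show ?thesis
  proof induction
    case base
    show ?case
      using thread_comp_key_columns[OF assms(1,2)] diagram_of_key_columns[of a M]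
          wc_0[OF assms(1)] assms(2)
      by (intro exI[of _ "key_columns M a"]) auto
  next
    case (step E E')
    then show ?case using kohnert_move_diagram_of below_trans by metis
  qed
qed

text \<open>A drop past several free positions is a chain of Kohnert moves, each to the next free
  position in column \<open>c\<close>. The last hypothesis ensures that the cell is again rightmost
  wherever it stops.\<close>

lemma kohnert_hop:
  assumes "(c, j) \<in> D" "\<And>c'. (c', j) \<in> D \<Longrightarrow> c' \<le> c" "1 \<le> i" "i < j" "(c, i) \<notin> D"
    and "\<And>t c'. i < t \<Longrightarrow> t < j \<Longrightarrow> (c, t) \<notin> D \<Longrightarrow> (c', t) \<in> D \<Longrightarrow> c' \<le> c"
  shows "kohnert_move\<^sup>*\<^sup>* D (insert (c, i) (D - {(c, j)}))"
  using assms
proof (induction j arbitrary: D rule: less_induct)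
  case (less j)
  define S where "S = {t. i \<le> t \<and> t < j \<and> (c, t) \<notin> D}"
  have "finite S" "i \<in> S" using less.prems by (auto simp: S_def)
  define s where "s = Max S"
  have "s \<in> S" using \<open>finite S\<close> \<open>i \<in> S\<close> unfolding s_def by (intro Max_in) auto
  then have s: "i \<le> s" "s < j" "(c, s) \<notin> D" by (auto simp: S_def)
  have full: "(c, t) \<in> D" if "s < t" "t < j" for t
    using Max_ge[OF \<open>finite S\<close>, of t] that s unfolding s_def S_def by fastforce
  let ?D = "insert (c, s) (D - {(c, j)})"
  have mv: "kohnert_move D ?D"
    by (rule kohnert_moveI) (use less.prems(1,2,3) s full in auto)
  show ?case
  proof (cases "s = i")
    case True
    then show ?thesis using mv by simp
  next
    case False
    have "kohnert_move\<^sup>*\<^sup>* ?D (insert (c, i) (?D - {(c, s)}))"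
    proof (rule less.IH)
      fix c' assume "(c', s) \<in> ?D"
      then show "c' \<le> c" using less.prems(6)[of s c'] s False by auto
    next
      fix t c' assume "i < t" "t < s" "(c, t) \<notin> ?D" "(c', t) \<in> ?D"
      then show "c' \<le> c" using less.prems(6)[of t c'] s by auto
    qed (use less.prems s False in auto)
    moreover have "insert (c, i) (?D - {(c, s)}) = insert (c, i) (D - {(c, j)})"
      using s by auto
    ultimately show ?thesis using mv by (metis converse_rtranclp_into_rtranclp)
  qed
qed

text \<open>The surplus cells of row \<open>j\<close> drop to row \<open>i\<close> one at a time,
  the rightmost first. In each such column a row in between is either occupied
  (\<open>a j \<le> a t\<close>) or ends before it (\<open>a t \<le> a i\<close>), as
  \<open>kohnert_hop\<close> demands.\<close>

lemma key_diagram_swap: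
  assumes "1 \<le> i" "i < j" "a i < a j" "\<And>t. i < t \<Longrightarrow> t < j \<Longrightarrow> a t \<le> a i \<or> a j \<le> a t"
  shows "kohnert_move\<^sup>*\<^sup>* (key_diagram a) (key_diagram (a(i := a j, j := a i)))"
proof -
  \<comment> \<open>\<open>E c\<close> is the stage at which the cells of row \<open>j\<close>
    beyond column \<open>c\<close> have been moved.\<close>
  define E where "E c = key_diagram (\<lambda>r. if r = j then c else a r) \<union>
      {(c', i) |c'. c < c' \<and> c' \<le> a j}" for c
  have step: "kohnert_move\<^sup>*\<^sup>* (E (Suc c)) (E c)" if "a i \<le> c" "Suc c \<le> a j" for c
  proof -
    have "kohnert_move\<^sup>*\<^sup>* (E (Suc c)) (insert (Suc c, i) (E (Suc c) - {(Suc c, j)}))"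
    proof (rule kohnert_hop)
      fix t c' assume t: "i < t" "t < j" "(Suc c, t) \<notin> E (Suc c)" "(c', t) \<in> E (Suc c)"
      then have "a t \<le> a i \<or> a j \<le> a t" using assms(4) by blast
      then show "c' \<le> Suc c" using t that assms(1) by (auto simp: E_def key_diagram_def)
    qed (use that assms in \<open>auto simp: E_def key_diagram_def\<close>)
    moreover have "insert (Suc c, i) (E (Suc c) - {(Suc c, j)}) = E c"
      using that assms(1,2) by (auto simp: E_def key_diagram_def split: if_splits)
    ultimately show ?thesis by simp
  qed
  have "kohnert_move\<^sup>*\<^sup>* (E (a j)) (E (a j - k))" if "k \<le> a j - a i" for k
    using that
  proof (induction k)
    case (Suc k)
    have "Suc (a j - Suc k) = a j - k" using Suc.prems by simp
    with Suc step[of "a j - Suc k"] show ?case by (auto intro: rtranclp_trans)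
  qed simp
  from this[of "a j - a i"] have "kohnert_move\<^sup>*\<^sup>* (E (a j)) (E (a i))" using assms(3) by simp
  moreover have "E (a j) = key_diagram a"
    by (auto simp: E_def key_diagram_def split: if_splits)
  moreover have "E (a i) = key_diagram (a(i := a j, j := a i))"
    using assms(1-3) by (auto simp: E_def key_diagram_def split: if_splits)
  ultimately show ?thesis by simp
qed

subsection \<open>The left swap order\<close>

lemma count_below_level_diff:
  "m \<le> m' \<Longrightarrow> count_below {i. m \<le> w i \<and> w i < m'} t + count_below (level w m') t
      = count_below (level w m) t"
  by (induction t) (auto simp: count_below_Suc level_def)

lemma count_below_interval_cong:
  assumes "s \<le> t" "\<And>u. s \<le> u \<Longrightarrow> u < t \<Longrightarrow> u \<in> X \<longleftrightarrow> u \<in> Y"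
  shows "count_below X t + count_below Y s = count_below Y t + count_below X s"
  using assms by (induction rule: dec_induct) (auto simp: count_below_Suc)

lemma count_below_interval_mono:
  assumes "s \<le> t" "\<And>u. s \<le> u \<Longrightarrow> u < t \<Longrightarrow> u \<in> X \<Longrightarrow> u \<in> Y"
  shows "count_below X t + count_below Y s \<le> count_below Y t + count_below X s"
  using assms by (induction rule: dec_induct) (auto simp: count_below_Suc)

lemma count_below_level_swap:
  assumes "i < j" "a i < a j"
  shows "count_below (level (a(i := a j, j := a i)) m) t =
    count_below (level a m) t + of_bool (i < t \<and> t \<le> j \<and> a i < m \<and> m \<le> a j)"
proof (induction t)
  case (Suc t)
  then show ?case
    using assms by (cases "t = i"; cases "t = j")
        (auto simp: count_below_Suc level_def less_Suc_eq Suc_le_eq)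
qed simp

text \<open>Together with \<open>rearrangement_less\<close> it makes weighted sums of the parts into
  measures for the inductions; the additive form avoids subtraction of natural numbers.\<close>

lemma sum_swap:
  fixes f a :: "nat \<Rightarrow> nat"
  assumes "i < j" "j \<le> n"
  shows "(\<Sum>r\<le>n. f r * (a(i := a j, j := a i)) r) + (f i * a i + f j * a j) =
    (\<Sum>r\<le>n. f r * a r) + (f i * a j + f j * a i)"
proof -
  let ?S = "{..n} - {i, j}"
  have S: "{..n} = insert i (insert j ?S)" using assms by auto
  have e: "(\<Sum>r\<in>?S. f r * (a(i := a j, j := a i)) r) = (\<Sum>r\<in>?S. f r * a r)"
    by (rule sum.cong) auto
  have "(\<Sum>r\<le>n. g r) = g i + (g j + (\<Sum>r\<in>?S. g r))" for g :: "nat \<Rightarrow> nat"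
    using assms by (subst S) (simp add: sum.insert)
  from this[of "\<lambda>r. f r * a r"] this[of "\<lambda>r. f r * (a(i := a j, j := a i)) r"] e
  show ?thesis using assms(1) by simp
qed

lemma swap_wc:
  "weak_composition n a \<Longrightarrow> 1 \<le> i \<Longrightarrow> i < j \<Longrightarrow> j \<le> n \<Longrightarrow> weak_composition n (a(i := a j, j := a i))"
  by (auto simp: weak_composition_def)

lemma rearrangement_less:
  fixes p q x y :: nat
  assumes "p < q" "x < y"
  shows "p * y + q * x < p * x + q * y"
proof -
  obtain d where d: "q = p + d" "0 < d" using assms(1) less_imp_add_positive by blast
  obtain e where e: "y = x + e" "0 < e" using assms(2) less_imp_add_positive by blast
  show ?thesis unfolding d(1) e(1) using d(2) e(2) by (simp add: algebra_simps)
qed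

lemma swap_below:
  assumes "i < j" "j \<le> n" "a i < a j"
  shows "below n (a(i := a j, j := a i)) a"
  using assms unfolding below_def by (simp add: count_below_level_swap)

text \<open>Let \<open>j\<close> be the last row where \<open>a\<close> and \<open>b\<close> differ;
  there \<open>b j < a j\<close>. The nearest row \<open>i\<close> below \<open>j\<close> with
  \<open>b j \<le> a i < a j\<close> can be exchanged with \<open>j\<close>, and the result still
  lies above \<open>b\<close>.\<close>

lemma below_imp_eq_or_swap:
  assumes "weak_composition n a" "weak_composition n b" "below n b a" "b \<noteq> a"
  obtains i j where "1 \<le> i" "i < j" "j \<le> n" "a i < a j"
    "\<And>t. i < t \<Longrightarrow> t < j \<Longrightarrow> a t \<le> a i \<or> a j \<le> a t" "below n b (a(i := a j, j := a i))"
proof -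
  have L: "count_below (level a m) t \<le> count_below (level b m) t" for m t
    using assms(3) by (cases "m = 0") (auto simp: below_def level_def)
  have T: "count_below (level a m) (Suc n) = count_below (level b m) (Suc n)" for m
    using assms(3) by (cases "m = 0") (auto simp: below_def level_def)
  define j where "j = Max {r. a r \<noteq> b r}"
  have sub: "{r. a r \<noteq> b r} \<subseteq> {1..n}" using assms(1,2) by (force simp: weak_composition_def)
  then have fin: "finite {r. a r \<noteq> b r}" by (rule finite_subset) simp
  have "{r. a r \<noteq> b r} \<noteq> {}" using assms(4) by auto
  then have "j \<in> {r. a r \<noteq> b r}" unfolding j_def using fin by (intro Max_in) auto
  then have j: "a j \<noteq> b j" "1 \<le> j" "j \<le> n" using sub by auto
  have above: "a r = b r" if "j < r" for r
    using Max_ge[OF fin, of r] that unfolding j_def by fastforce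
  have eq: "count_below (level a m) (Suc j) = count_below (level b m) (Suc j)" for m
  proof -
    have "count_below (level a m) (Suc n) + count_below (level b m) (Suc j)
        = count_below (level b m) (Suc n) + count_below (level a m) (Suc j)"
      using j(3) above by (intro count_below_interval_cong) (auto simp: level_def)
    then show ?thesis using T[of m] by simp
  qed
  have at: "count_below (level a m) j + of_bool (m \<le> a j)
      = count_below (level b m) j + of_bool (m \<le> b j)" for m
    using eq[of m] by (simp add: count_below_Suc level_def)
  have "b j \<le> a j"
    using at[of "b j"] L[of "b j" j] by (auto split: if_splits simp: of_bool_def)
  then have bj: "b j < a j" using j(1) by simp
  let ?Y = "{i. b j \<le> a i \<and> a i < a j}"
  \<comment> \<open>Below row \<open>j\<close> both have equally many parts
    \<open>\<ge> b j\<close>, but \<open>a\<close> has one fewer part \<open>\<ge> a j\<close>; so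
    \<open>a\<close> has a part in \<open>?Y\<close>.\<close>
  have "\<exists>i. 1 \<le> i \<and> i < j \<and> i \<in> ?Y"
  proof (rule count_below_less_ex)
    have Y: "count_below ?Y t + count_below (level a (a j)) t = count_below (level a (b j)) t" for t
      by (rule count_below_level_diff) (use bj in simp)
    have Z: "count_below {i. b j \<le> b i \<and> b i < a j} t + count_below (level b (a j)) t
        = count_below (level b (b j)) t" for t
      by (rule count_below_level_diff) (use bj in simp)
    have "count_below {i. b j \<le> b i \<and> b i < a j} 1 \<le> count_below {i. b j \<le> b i \<and> b i < a j} j"
      by (rule count_below_mono) (use j in simp)
    moreover have "count_below {i. b j \<le> b i \<and> b i < a j} 1 = count_below ?Y 1"
      using wc_0[OF assms(1)] wc_0[OF assms(2)] by (simp add: count_below_Suc)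
    moreover have "count_below (level a (a j)) j + 1 = count_below (level b (a j)) j"
        using at[of "a j"] bj by simp
    moreover have "count_below (level a (b j)) j = count_below (level b (b j)) j"
        using at[of "b j"] bj by simp
    ultimately show "count_below ?Y 1 < count_below ?Y j" using Y[of j] Z[of j] by linarith
  qed
  then have ne: "{i. 1 \<le> i \<and> i < j \<and> i \<in> ?Y} \<noteq> {}" by blast
  have fin2: "finite {i. 1 \<le> i \<and> i < j \<and> i \<in> ?Y}" by simp
  define i where "i = Max {i. 1 \<le> i \<and> i < j \<and> i \<in> ?Y}"
  have "i \<in> {i. 1 \<le> i \<and> i < j \<and> i \<in> ?Y}" unfolding i_def by (rule Max_in[OF fin2 ne])
  then have i: "1 \<le> i" "i < j" "b j \<le> a i" "a i < a j" by auto
  have btw: "a t < b j \<or> a j \<le> a t" if "i < t" "t < j" for t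
    using Max_ge[OF fin2, of t] that i unfolding i_def[symmetric] by fastforce
  have "below n b (a(i := a j, j := a i))"
    unfolding below_def
  proof (intro allI impI conjI)
    fix m t :: nat assume m: "1 \<le> m"
    show "count_below (level (a(i := a j, j := a i)) m) (Suc n) = count_below (level b m) (Suc n)"
      using T[of m] i j by (simp add: count_below_level_swap)
    show "count_below (level (a(i := a j, j := a i)) m) t \<le> count_below (level b m) t"
    proof (cases "i < t \<and> t \<le> j \<and> a i < m \<and> m \<le> a j")
      case True
      \<comment> \<open>The swap costs one at \<open>t\<close>. At \<open>j\<close> there is a
        surplus of one, and it persists back to \<open>t\<close>: in between \<open>a\<close> has no
        parts in \<open>?Y\<close>, while \<open>level b m\<close> is contained in
        \<open>level b (b j)\<close>.\<close>
      have 1: "count_below (level a m) j + count_below (level a (b j)) t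
          = count_below (level a (b j)) j + count_below (level a m) t"
      proof (rule count_below_interval_cong)
        fix u assume "t \<le> u" "u < j"
        then show "u \<in> level a m \<longleftrightarrow> u \<in> level a (b j)"
          using btw[of u] True i by (auto simp: level_def)
      qed (use True in simp)
      have 2: "count_below (level b m) j + count_below (level b (b j)) t
          \<le> count_below (level b (b j)) j + count_below (level b m) t"
        by (rule count_below_interval_mono) (use True i in \<open>auto simp: level_def\<close>)
      have 3: "count_below (level b m) j = count_below (level a m) j + 1"
          using at[of m] True i by simp
      have 4: "count_below (level b (b j)) j = count_below (level a (b j)) j"
          using at[of "b j"] bj by simp
      show ?thesis using 1 2 3 4 L[of "b j" t] True i by (simp add: count_below_level_swap)
    qed (use L[of m t] i in \<open>auto simp: count_below_level_swap\<close>)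
  qed
  moreover have "a t \<le> a i \<or> a j \<le> a t" if "i < t" "t < j" for t
    using btw[OF that] i(3) by auto
  ultimately show ?thesis using that i j by blast
qed

text \<open>Iterates \<open>below_imp_eq_or_swap\<close>: each swap lowers the sum of
  \<open>r * a r\<close> and is at once a left swap and a chain of Kohnert moves on key
  diagrams.\<close>

lemma below_imp_reachable:
  assumes "weak_composition n a" "weak_composition n b" "below n b a"
  shows "left_swap_le n b a \<and> kohnert_move\<^sup>*\<^sup>* (key_diagram a) (key_diagram b)"
  using assms
proof (induction "\<Sum>r\<le>n. r * a r" arbitrary: a rule: less_induct)
  case less
  show ?case
  proof (cases "b = a")
    case False
    obtain i j where ij: "1 \<le> i" "i < j" "j \<le> n" "a i < a j"
      "\<And>t. i < t \<Longrightarrow> t < j \<Longrightarrow> a t \<le> a i \<or> a j \<le> a t" and le: "below n b (a(i := a j, j := a i))"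
      using below_imp_eq_or_swap[OF less.prems False] by metis
    let ?a = "a(i := a j, j := a i)"
    have "(\<Sum>r\<le>n. r * ?a r) < (\<Sum>r\<le>n. r * a r)"
      using sum_swap[OF ij(2,3), of "\<lambda>r. r" a] rearrangement_less[OF ij(2,4)] by linarith
    then have IH: "left_swap_le n b ?a" "kohnert_move\<^sup>*\<^sup>* (key_diagram ?a) (key_diagram b)"
      using less.hyps[OF _ swap_wc[OF less.prems(1) ij(1-3)] less.prems(2) le] by auto
    have "left_swap n ?a a" unfolding left_swap_def using ij(1-4) by blast
    then have "left_swap_le n b a"
      using IH(1) unfolding left_swap_le_def by (rule rtranclp.rtrancl_into_rtrancl[rotated])
    then show ?thesis using key_diagram_swap[OF ij(1,2,4,5)] IH(2) by (meson rtranclp_trans)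
  qed (auto simp: left_swap_le_def)
qed

lemma left_swap_imp_below:
  "weak_composition n a \<Longrightarrow> left_swap n b a \<Longrightarrow> weak_composition n b \<and> below n b a"
  unfolding left_swap_def using swap_wc swap_below by metis

lemma left_swap_le_imp_below:
  assumes "left_swap_le n b a" "weak_composition n a"
  shows "weak_composition n b \<and> below n b a"
  using assms unfolding left_swap_le_def
proof (induction rule: converse_rtranclp_induct)
  case (step x y)
  then show ?case using left_swap_imp_below below_trans by metis
qed simp

text \<open>The first column \<open>C\<close> is already that of the key diagram and stays fixed.
  The matching only moved threads upwards, so the rest \<open>?v\<close> of the key lies above
  \<open>?w\<close>; hence the key diagram of \<open>?w\<close> can be reached, and the induction
  continues from there.\<close>

lemma diagram_of_in_KD_thread_comp:
  assumes "valid_columns n T"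
  shows "kohnert_move\<^sup>*\<^sup>* (key_diagram (thread_comp T)) (diagram_of T)"
  using assms
proof (induction T)
  case Nil
  have "key_diagram (\<lambda>_. 0) = {}" by (auto simp: key_diagram_def)
  then show ?case by simp
next
  case (Cons C T)
  let ?w = "thread_comp T" and ?v = "\<lambda>r. push_col C (thread_comp T) r - 1"
  have v: "C \<subseteq> {1..n}" "valid_columns n T" "carry C (level ?w 1) (Suc n) = 0"
      using Cons.prems by auto
  note wc = thread_comp_wc[OF v(2)] and wc' = wc_minus_1[OF push_col_wc[OF v(1), of ?w]]
  have "below n ?w ?v"
    unfolding below_def
  proof (intro allI impI)
    fix m :: nat assume m: "1 \<le> m"
    have "carry C (level ?w m) (Suc n) = 0" using carry_le_zero[OF level_antimono[OF m] v(3)] .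
    then show "(\<forall>t. count_below (level ?v m) t \<le> count_below (level ?w m) t)
        \<and> count_below (level ?v m) (Suc n) = count_below (level ?w m) (Suc n)"
      unfolding level_minus_1[OF m] level_push_col_Suc[OF wc m]
          by (simp add: count_below_match_up_le count_below_match_up_total)
  qed
  then have "kohnert_move\<^sup>*\<^sup>* (key_diagram ?v) (key_diagram ?w)"
    using below_imp_reachable[OF wc' wc] by blast
  then have "kohnert_move\<^sup>*\<^sup>* (key_diagram ?v) (diagram_of T)"
    using Cons.IH[OF v(2)] by simp
  then have "kohnert_move\<^sup>*\<^sup>* (cons_col C (key_diagram ?v)) (cons_col C (diagram_of T))"
    using kohnert_moves_cons_col by (auto simp: key_diagram_def)
  moreover have "key_diagram (push_col C ?w) = cons_col C (key_diagram ?v)"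
    using key_diagram_cons[of "push_col C ?w"] wc_0[OF push_col_wc[OF v(1)]] by simp
  ultimately show ?case by simp
qed

text \<open>Moves from the key diagram of \<open>a\<close> only lower \<theta>; conversely, this key
  diagram leads to the one of \<theta>(T) and from there to \<open>T\<close>.\<close>

lemma KD_eq:
  assumes "weak_composition n a" "\<And>r. a r \<le> M"
  shows "KD a = diagram_of ` {T. length T = M \<and> valid_columns n T \<and> below n (thread_comp T) a}"
proof (intro equalityI subsetI)
  fix D assume "D \<in> KD a"
  then show "D \<in> diagram_of ` {T. length T = M \<and> valid_columns n T \<and> below n (thread_comp T) a}"
    using KD_imp_thread_comp_below[OF assms] by blast
next
  fix D assume "D \<in> diagram_of ` {T. length T = M \<and> valid_columns n T \<and> below n (thread_comp T) a}"
  then obtain T where T: "D = diagram_of T" "valid_columns n T" "below n (thread_comp T) a" by blast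
  have "kohnert_move\<^sup>*\<^sup>* (key_diagram a) (key_diagram (thread_comp T))"
    using below_imp_reachable[OF assms(1) thread_comp_wc[OF T(2)] T(3)] by blast
  also have "kohnert_move\<^sup>*\<^sup>* (key_diagram (thread_comp T)) D"
      using diagram_of_in_KD_thread_comp[OF T(2)] T(1) by simp
  finally show "D \<in> KD a" by (simp add: KD_def)
qed

text \<open>The length is fixed because trailing empty columns leave the diagram unchanged.\<close>

lemma inj_on_diagram_of: "inj_on diagram_of {T. length T = M}"
proof (rule inj_onI)
  fix S T :: "nat set list"
  assume "S \<in> {T. length T = M}" "T \<in> {T. length T = M}" "diagram_of S = diagram_of T"
  then have "length S = length T" "diagram_of S = diagram_of T" by auto
  then show "S = T"
  proof (induction rule: list_induct2)
    case (Cons C S D T)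
    have mem: "(c, r) \<in> cons_col C (diagram_of S) \<longleftrightarrow> (c, r) \<in> cons_col D (diagram_of T)" for c r
      using Cons.prems by simp
    have "C = D" using mem[of "Suc 0"] by auto
    moreover have "(c, r) \<in> diagram_of S \<longleftrightarrow> (c, r) \<in> diagram_of T" for c r
      using mem[of "Suc c" r] diagram_of_pos[of c r] by (cases c) auto
    then have "diagram_of S = diagram_of T" by auto
    ultimately show ?case using Cons.IH by simp
  qed simp
qed

subsection \<open>Adding a box\<close>

text \<open>
  The inequalities say that \<open>d\<close> lies below \<open>a\<close> with a box added to column \<open>q\<close> in a row \<open>\<le> k\<close>; for
  \<open>q = 0\<close> there is no box.
\<close>

definition box_below :: "nat \<Rightarrow> (nat \<Rightarrow> nat) \<Rightarrow> nat \<Rightarrow> nat \<Rightarrow> (nat \<Rightarrow> nat) \<Rightarrow> bool" where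
  "box_below n a k q d \<longleftrightarrow> (\<forall>m\<ge>1.
     (\<forall>t. count_below (level a m) t + of_bool (m = q \<and> k < t) \<le> count_below (level d m) t) \<and>
     count_below (level a m) (Suc n) + of_bool (m = q) = count_below (level d m) (Suc n))"

lemma count_below_level_plus_unit:
  "count_below (level (b + unit_comp j) m) t
      = count_below (level b m) t + of_bool (m = Suc (b j) \<and> j < t)"
proof (induction t)
  case (Suc t)
  then show ?case
    by (cases "t = j") (auto simp: count_below_Suc level_def unit_comp_def less_Suc_eq)
qed simp

lemma wc_plus_unit:
  "weak_composition n b \<Longrightarrow> 1 \<le> j \<Longrightarrow> j \<le> n \<Longrightarrow> weak_composition n (b + unit_comp j)"
  by (auto simp: weak_composition_def unit_comp_def)

text \<open>The box sits in row \<open>j\<close> and column \<open>Suc (b j)\<close>; as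
  \<open>j \<le> k\<close>, every \<open>t\<close> beyond \<open>k\<close> counts it.\<close>

lemma below_imp_box_below:
  assumes "below n b a" "below n d (b + unit_comp j)" "1 \<le> j" "j \<le> k" "k \<le> n"
  shows "box_below n a k (Suc (b j)) d"
  unfolding box_below_def
proof (intro allI impI conjI)
  fix m t :: nat assume m: "1 \<le> m"
  have 1: "count_below (level a m) t \<le> count_below (level b m) t"
      "count_below (level a m) (Suc n) = count_below (level b m) (Suc n)" for t
    using assms(1) m by (auto simp: below_def)
  have 2: "count_below (level b m) t + of_bool (m = Suc (b j) \<and> j < t) \<le> count_below (level d m) t"
    "count_below (level b m) (Suc n) + of_bool (m = Suc (b j) \<and> j < Suc n)
        = count_below (level d m) (Suc n)" for t
    using assms(2) m by (auto simp: below_def count_below_level_plus_unit)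
  show "count_below (level a m) t + of_bool (m = Suc (b j) \<and> k < t) \<le> count_below (level d m) t"
    using 1(1)[of t] 2(1)[of t] assms(4) by (auto simp: of_bool_def split: if_splits)
  show "count_below (level a m) (Suc n) + of_bool (m = Suc (b j)) = count_below (level d m) (Suc n)"
    using 1(2) 2(2) assms(4,5) by (auto simp: of_bool_def)
qed

text \<open>
  Let \<open>i\<close> be the largest row \<open>\<le> k\<close> below which \<open>a\<close> and \<open>d\<close> have equally many parts \<open>\<ge> q\<close>. If \<open>d\<^sub>i = q\<close>, the
  box can be removed from row \<open>i\<close>; otherwise \<open>d\<^sub>i > q\<close>, and exchanging \<open>d\<^sub>i\<close> with the next part in
  \<open>[q, d\<^sub>i)\<close> above it gives a larger composition satisfying the same inequalities.
\<close>

lemma box_below_imp_below: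
  assumes "weak_composition n a" "weak_composition n d" "k \<le> n" "1 \<le> q" "box_below n a k q d"
  shows "\<exists>b j. weak_composition n b \<and> below n b a \<and> 1 \<le> j \<and> j \<le> k \<and> below n d (b + unit_comp j)"
  using assms(2,5)
\<comment> \<open>The weights \<open>n - r\<close> decrease upwards, so the measure drops when a
  swap moves the larger part up.\<close>
proof (induction "\<Sum>r\<le>n. (n - r) * d r" arbitrary: d rule: less_induct)
  case less
  note wd = less.prems(1)
  have L: "count_below (level a m) t + of_bool (m = q \<and> k < t) \<le> count_below (level d m) t"
      if "1 \<le> m" for m t
    using less.prems(2) that by (simp add: box_below_def)
  have T: "count_below (level a m) (Suc n) + of_bool (m = q) = count_below (level d m) (Suc n)"
      if "1 \<le> m" for m
    using less.prems(2) that by (simp add: box_below_def)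
  define P where "P r \<longleftrightarrow> r \<le> k \<and> count_below (level a q) r = count_below (level d q) r" for r
  have d0: "count_below (level d q) 1 = 0" "count_below (level a q) 1 = 0"
    using wc_0[OF wd] wc_0[OF assms(1)] assms(4) by (auto simp: count_below_Suc level_def)
  have k: "1 \<le> k" using L[OF assms(4), of 1] d0 by (auto simp: of_bool_def split: if_splits)
  have P1: "P 1" using d0 k by (simp add: P_def)
  define i where "i = Max {r. P r}"
  have fin: "finite {r. P r}" by (rule finite_subset[of _ "{..k}"]) (auto simp: P_def)
  have "i \<in> {r. P r}" unfolding i_def using fin P1 by (intro Max_in) auto
  then have i: "i \<le> k" "count_below (level a q) i = count_below (level d q) i" by (auto simp: P_def)
  have i1: "1 \<le> i" using Max_ge[OF fin, of 1] P1 unfolding i_def by simp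
  \<comment> \<open>Beyond \<open>i\<close> the inequality for \<open>q\<close> has one to spare: up
    to \<open>k\<close> by maximality of \<open>i\<close>, afterwards because of the box.\<close>
  have slack: "count_below (level a q) t + 1 \<le> count_below (level d q) t" if "i < t" for t
  proof (cases "t \<le> k")
    case True
    have "\<not> P t" using Max_ge[OF fin, of t] that unfolding i_def by fastforce
    then show ?thesis using L[OF assms(4), of t] True by (simp add: P_def)
  qed (use L[OF assms(4), of t] in simp)
  have di: "q \<le> d i"
    using slack[of "Suc i"] i(2) by (auto simp: count_below_Suc level_def of_bool_def split:
        if_splits)
  show ?case
  proof (cases "d i = q")
    case True
    let ?b = "d(i := q - 1)"
    have b: "?b + unit_comp i = d"
      using True assms(4) by (auto simp: unit_comp_def fun_eq_iff)
    have e: "count_below (level d m) t = count_below (level ?b m) t + of_bool (m = q \<and> i < t)"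
        for m t
      using count_below_level_plus_unit[of ?b i m t] assms(4) unfolding b by simp
    have "below n ?b a"
      unfolding below_def
    proof (intro allI impI conjI)
      fix m t :: nat assume m: "1 \<le> m"
      show "count_below (level a m) t \<le> count_below (level ?b m) t"
        using L[OF m, of t] slack[of t] e[of m t] by (cases "m = q \<and> i < t") auto
      show "count_below (level a m) (Suc n) = count_below (level ?b m) (Suc n)"
        using T[OF m] e[of m "Suc n"] i assms(3) by auto
    qed
    moreover have "weak_composition n ?b"
        using wd i1 i assms(3) by (auto simp: weak_composition_def)
    ultimately show ?thesis using b i i1 below_refl by metis
  next
    case False
    then have qi: "q < d i" using di by simp
    have mono: "count_below (level a m) t + count_below (level a q) i
        \<le> count_below (level a q) t + count_below (level a m) i"
      if "q \<le> m" "i \<le> t" for m t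
      by (rule count_below_interval_mono) (use that in \<open>auto simp: level_def\<close>)
    have ini: "count_below (level d m) (Suc i) = count_below (level d m) i + 1" if "m \<le> d i" for m
      using that by (simp add: count_below_Suc level_def)
    let ?Y = "{j. q \<le> d j \<and> d j < d i}"
    \<comment> \<open>From row \<open>i\<close> upwards \<open>a\<close> has at least as many parts
      \<open>\<ge> q\<close> as parts \<open>\<ge> d i\<close>. Comparing totals, where only column
      \<open>q\<close> has gained a box, leaves \<open>d\<close> a part in \<open>?Y\<close> above
      row \<open>i\<close>.\<close>
    have "\<exists>j. Suc i \<le> j \<and> j < Suc n \<and> j \<in> ?Y"
    proof (rule count_below_less_ex)
      have Y: "count_below ?Y t + count_below (level d (d i)) t = count_below (level d q) t" for t
        by (rule count_below_level_diff) (use qi in simp)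
      have "count_below (level a (d i)) i \<le> count_below (level d (d i)) i"
          using L[of "d i" i] qi by simp
      moreover have "count_below (level a (d i)) (Suc n) = count_below (level d (d i)) (Suc n)"
          using T[of "d i"] qi by simp
      moreover have "count_below (level a q) (Suc n) + 1 = count_below (level d q) (Suc n)"
          using T[OF assms(4)] by simp
      ultimately show "count_below ?Y (Suc i) < count_below ?Y (Suc n)"
        using Y[of "Suc i"] Y[of "Suc n"] ini[of q] ini[of "d i"] qi mono[of "d i" "Suc n"] i
            assms(3)
        by linarith
    qed
    then have ne: "{j. Suc i \<le> j \<and> j < Suc n \<and> j \<in> ?Y} \<noteq> {}" by blast
    have fin2: "finite {j. Suc i \<le> j \<and> j < Suc n \<and> j \<in> ?Y}" by simp
    define j where "j = Min {j. Suc i \<le> j \<and> j < Suc n \<and> j \<in> ?Y}"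
    have "j \<in> {j. Suc i \<le> j \<and> j < Suc n \<and> j \<in> ?Y}" unfolding j_def by (rule Min_in[OF fin2 ne])
    then have j: "i < j" "j \<le> n" "q \<le> d j" "d j < d i" by auto
    have btw: "d t < q \<or> d i \<le> d t" if "i < t" "t < j" for t
      using Min_le[OF fin2, of t] that j unfolding j_def[symmetric] by fastforce
    let ?d = "d(i := d j, j := d i)"
    have d: "d = ?d(i := ?d j, j := ?d i)" using j by auto
    have lt: "?d i < ?d j" using j by simp
    have e: "count_below (level d m) t = count_below (level ?d m) t
        + of_bool (i < t \<and> t \<le> j \<and> d j < m \<and> m \<le> d i)" for m t
      using count_below_level_swap[of i j ?d m t, OF j(1) lt, folded d] j by simp
    have "(\<Sum>r\<le>n. (n - r) * ?d r) < (\<Sum>r\<le>n. (n - r) * d r)"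
      using sum_swap[of i j n "\<lambda>r. n - r" ?d, OF j(1,2), folded d] j
        rearrangement_less[of "n - j" "n - i" "d j" "d i", OF diff_less_mono2] by simp
    moreover have "box_below n a k q ?d"
      unfolding box_below_def
    proof (intro allI impI conjI)
      fix m t :: nat assume m: "1 \<le> m"
      show "count_below (level a m) t + of_bool (m = q \<and> k < t) \<le> count_below (level ?d m) t"
      proof (cases "i < t \<and> t \<le> j \<and> d j < m \<and> m \<le> d i")
        case True
        have "count_below (level d m) t + count_below (level d q) (Suc i)
            = count_below (level d q) t + count_below (level d m) (Suc i)"
        proof (rule count_below_interval_cong)
          fix u assume "Suc i \<le> u" "u < t"
          then show "u \<in> level d m \<longleftrightarrow> u \<in> level d q"
            using btw[of u] True j by (auto simp: level_def)
        qed (use True in simp)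
        moreover have "count_below (level a m) i \<le> count_below (level d m) i"
            using L[OF m, of i] by simp
        ultimately have "count_below (level a m) t + 1 \<le> count_below (level d m) t"
          using True ini[of m] ini[of q] qi slack[of t] mono[of m t] i j by simp
        then show ?thesis using e[of m t] True j by simp
      qed (use L[OF m, of t] e[of m t] in auto)
      show "count_below (level a m) (Suc n) + of_bool (m = q) = count_below (level ?d m) (Suc n)"
        using T[OF m] e[of m "Suc n"] j by simp
    qed
    moreover have "weak_composition n ?d" using swap_wc[OF wd i1 j(1,2)] .
    ultimately obtain b l where "weak_composition n b" "below n b a" "1 \<le> l" "l \<le> k"
        "below n ?d (b + unit_comp l)"
      using less.hyps by blast
    moreover have "below n d ?d"
      using swap_below[of i j n ?d, OF j(1,2) lt, folded d] .
    ultimately show ?thesis using below_trans by blast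
  qed
qed

text \<open>The set L(a, k). The column \<open>q\<close> of the box is determined by
  \<open>a\<close> and \<open>d\<close>; see \<open>box_ideal_identity\<close>.\<close>

definition box_ideal :: "nat \<Rightarrow> (nat \<Rightarrow> nat) \<Rightarrow> nat \<Rightarrow> (nat \<Rightarrow> nat) set" where
  "box_ideal n a k = {d. weak_composition n d \<and> (\<exists>q\<ge>1. box_below n a k q d)}"

lemma below_bound:
  assumes "below n b a" "weak_composition n b" "\<And>r. a r \<le> M"
  shows "b r \<le> M"
proof (rule ccontr)
  assume "\<not> b r \<le> M"
  then have r: "r \<in> level b (Suc M)" by (simp add: level_def)
  then have "r \<le> n" using level_wc[OF assms(2), of "Suc M"] by auto
  then have "count_below (level b (Suc M)) (Suc r) \<le> count_below (level b (Suc M)) (Suc n)"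
      by (intro count_below_mono) simp
  moreover have "0 < count_below (level b (Suc M)) (Suc r)" using r by (simp add: count_below_Suc)
  ultimately have "0 < count_below (level b (Suc M)) (Suc n)" by linarith
  moreover have "level a (Suc M) = {}" using assms(3) by (auto simp: level_def not_less_eq_eq)
  moreover have "count_below (level a (Suc M)) (Suc n) = count_below (level b (Suc M)) (Suc n)"
    using assms(1) by (simp add: below_def)
  ultimately show False by simp
qed

text \<open>The inequalities of \<open>box_below\<close> replace the choice of \<open>b\<close> and
  \<open>j\<close>: \<open>below_imp_box_below\<close> gives one direction,
  \<open>box_below_imp_below\<close> the other. The length \<open>Suc M\<close> leaves room for the
  box.\<close>

lemma union_KD_eq:
  assumes "weak_composition n a" "\<And>r. a r \<le> M" "k \<le> n"
  shows "(\<Union>b \<in> {b. left_swap_le n b a}. \<Union>j \<in> {1..k}. KD (b + unit_comp j)) =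
    diagram_of ` {T. length T = Suc M \<and> valid_columns n T \<and> thread_comp T \<in> box_ideal n a k}"
    (is "?U = diagram_of ` ?V")
proof -
  have K: "KD (b + unit_comp j) = diagram_of `
      {T. length T = Suc M \<and> valid_columns n T \<and> below n (thread_comp T) (b + unit_comp j)}"
    if "below n b a" "weak_composition n b" "1 \<le> j" "j \<le> k" for b j
  proof (rule KD_eq)
    show "weak_composition n (b + unit_comp j)" using that assms(3) by (intro wc_plus_unit) auto
    show "(b + unit_comp j) r \<le> Suc M" for r
      using below_bound[OF that(1,2) assms(2), of r] by (auto simp: unit_comp_def)
  qed
  show ?thesis
  proof (intro equalityI subsetI)
    fix D assume "D \<in> ?U"
    then obtain b j where b: "left_swap_le n b a" "1 \<le> j" "j \<le> k" "D \<in> KD (b + unit_comp j)" by auto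
    have b': "weak_composition n b" "below n b a"
        using left_swap_le_imp_below[OF b(1) assms(1)] by auto
    obtain T where T: "D = diagram_of T" "length T = Suc M" "valid_columns n T"
        "below n (thread_comp T) (b + unit_comp j)"
      using b(4) K[OF b'(2,1) b(2,3)] by auto
    have "box_below n a k (Suc (b j)) (thread_comp T)"
        by (rule below_imp_box_below[OF b'(2) T(4) b(2,3) assms(3)])
    then have "thread_comp T \<in> box_ideal n a k"
        using thread_comp_wc[OF T(3)] by (auto simp: box_ideal_def)
    then show "D \<in> diagram_of ` ?V" using T by blast
  next
    fix D assume "D \<in> diagram_of ` ?V"
    then obtain T q where T: "D = diagram_of T" "length T = Suc M" "valid_columns n T" "1 \<le> q"
        "box_below n a k q (thread_comp T)"
      by (auto simp: box_ideal_def)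
    obtain b j where b: "weak_composition n b" "below n b a" "1 \<le> j" "j \<le> k"
        "below n (thread_comp T) (b + unit_comp j)"
      using box_below_imp_below[OF assms(1) thread_comp_wc[OF T(3)] assms(3) T(4,5)] by blast
    have "D \<in> KD (b + unit_comp j)" using K[OF b(2,1,3,4)] T b(5) by blast
    moreover have "left_swap_le n b a" using below_imp_reachable[OF assms(1) b(1,2)] by blast
    moreover have "j \<in> {1..k}" using b(3,4) by simp
    ultimately show "D \<in> ?U" by blast
  qed
qed

subsection \<open>Adjacent transpositions\<close>

text \<open>The generating function of diagrams weighted by \<open>g\<close> at \<theta>(T), built
  column by column (see \<open>thread_sum_eq_sum\<close>). The weight is arbitrary for the sake of
  induction: fixing the first column turns \<open>g\<close> into another weight on the remaining
  columns.\<close>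

primrec thread_sum :: "nat \<Rightarrow> nat \<Rightarrow> ((nat \<Rightarrow> nat) \<Rightarrow> real) \<Rightarrow> (nat \<Rightarrow> real) \<Rightarrow> real" where
  "thread_sum n 0 g x = g (\<lambda>_. 0)"
| "thread_sum n (Suc M) g x = (\<Sum>C\<in>Pow {1..n}. (\<Prod>r\<in>C. x r) *
     thread_sum n M (\<lambda>w. if carry C (level w 1) (Suc n) = 0 then g (push_col C w) else 0) x)"

lemma thread_sum_cong:
  assumes "\<And>w. weak_composition n w \<Longrightarrow> g w = h w"
  shows "thread_sum n M g x = thread_sum n M h x"
  using assms
proof (induction M arbitrary: g h)
  case 0
  then show ?case by (simp add: weak_composition_def)
next
  case (Suc M)
  show ?case
    unfolding thread_sum.simps by (intro sum.cong refl arg_cong2[where f = "(*)"] Suc.IH)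
        (use Suc.prems push_col_wc in auto)
qed

lemma thread_sum_add: "thread_sum n M (\<lambda>w. g w + h w) x = thread_sum n M g x + thread_sum n M h x"
proof (induction M arbitrary: g h)
  case (Suc M)
  have "thread_sum n M (\<lambda>w. if c w then g (p w) + h (p w) else 0) x =
      thread_sum n M (\<lambda>w. if c w then g (p w) else 0) x
          + thread_sum n M (\<lambda>w. if c w then h (p w) else 0) x" for c p
    unfolding Suc[symmetric] by (rule thread_sum_cong) simp
  then show ?case by (simp add: sum.distrib distrib_left)
qed simp

lemma thread_sum_zero: "thread_sum n M (\<lambda>w. 0) x = 0"
  by (induction M) auto

lemma thread_sum_diff: "thread_sum n M (\<lambda>w. g w - h w) x = thread_sum n M g x - thread_sum n M h x"
  using thread_sum_add[of n M "\<lambda>w. g w - h w" h x] by simp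

lemma level_comp: "level (w \<circ> f) m = f -` level w m"
  by (auto simp: level_def)

locale adjacent_swap =
  fixes n i :: nat
  assumes i: "1 \<le> i" "Suc i \<le> n"
begin

abbreviation \<tau> :: "nat \<Rightarrow> nat" where "\<tau> \<equiv> transpose i (Suc i)"

definition top_comp :: "(nat \<Rightarrow> nat) \<Rightarrow> nat \<Rightarrow> nat" where
  "top_comp w = (if w i < w (Suc i) then w \<circ> \<tau> else w)"

lemma tau_tau [simp]: "w \<circ> \<tau> \<circ> \<tau> = w"
  by (simp add: comp_assoc)

lemma tau_other: "r \<noteq> i \<Longrightarrow> r \<noteq> Suc i \<Longrightarrow> \<tau> r = r"
  by simp

lemma tau_vimage_vimage [simp]: "\<tau> -` \<tau> -` Y = Y"
  by auto

lemma wc_tau: "weak_composition n w \<Longrightarrow> weak_composition n (w \<circ> \<tau>)"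
  using i by (auto simp: weak_composition_def transpose_def)

lemma tau_vimage_subset: "C \<subseteq> {1..n} \<Longrightarrow> \<tau> -` C \<subseteq> {1..n}"
  using i by (auto simp: transpose_def split: if_splits)

lemma sym_tau_vimage:
  assumes "i \<in> C \<longleftrightarrow> Suc i \<in> C" shows "\<tau> -` C = C"
proof -
  have "\<tau> r \<in> C \<longleftrightarrow> r \<in> C" for r
    using assms by (cases "r = i"; cases "r = Suc i") auto
  then show ?thesis by auto
qed

lemma carry_after:
  assumes "carry C X (Suc (Suc i)) = carry D Y (Suc (Suc i))" "Suc (Suc i) \<le> t"
    "\<And>r. r \<noteq> i \<Longrightarrow> r \<noteq> Suc i \<Longrightarrow> r \<in> X \<longleftrightarrow> r \<in> Y" "\<And>r. r \<noteq> i \<Longrightarrow> r \<noteq> Suc i \<Longrightarrow> r \<in> C \<longleftrightarrow> r \<in> D"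
  shows "carry C X t = carry D Y t"
  by (rule carry_cong_from[OF assms(1,2)]; rule assms(3,4); simp)

text \<open>Once the numbers waiting above both rows agree, the scan proceeds identically; so an
  exchange of the two rows only requires a computation inside them.\<close>

lemma match_up_local:
  assumes "\<And>r. r \<noteq> i \<Longrightarrow> r \<noteq> Suc i \<Longrightarrow> r \<in> X \<longleftrightarrow> r \<in> Y" "\<And>r. r \<noteq> i \<Longrightarrow> r \<noteq> Suc i \<Longrightarrow> r \<in> C \<longleftrightarrow> r \<in> D"
    and "carry C X (Suc (Suc i)) = carry D Y (Suc (Suc i))"
  shows "carry C X (Suc n) = carry D Y (Suc n)"
    and "r \<noteq> i \<Longrightarrow> r \<noteq> Suc i \<Longrightarrow> r \<in> match_up C X \<longleftrightarrow> r \<in> match_up D Y"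
proof -
  have c: "carry C X t = carry D Y t" if "t \<noteq> Suc i" for t
  proof (cases "t \<le> i")
    case True
    then show ?thesis by (intro carry_cong assms(1,2)) simp_all
  next
    case False
    then have "Suc (Suc i) \<le> t" using that by simp
    then show ?thesis by (rule carry_after[OF assms(3) _ assms(1,2)])
  qed
  show "carry C X (Suc n) = carry D Y (Suc n)" using i by (intro c) auto
  show "r \<in> match_up C X \<longleftrightarrow> r \<in> match_up D Y" if "r \<noteq> i" "r \<noteq> Suc i"
    using c[OF that(2)] assms(1,2)[OF that] by (simp add: match_up_def)
qed

lemma tau_mem [simp]: "i \<in> \<tau> -` Y \<longleftrightarrow> Suc i \<in> Y" "Suc i \<in> \<tau> -` Y \<longleftrightarrow> i \<in> Y"
  by auto

lemma tau_mem_other: "r \<noteq> i \<Longrightarrow> r \<noteq> Suc i \<Longrightarrow> r \<in> \<tau> -` Y \<longleftrightarrow> r \<in> Y"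
  by simp

lemma carry_tau_i: "carry (\<tau> -` C) (\<tau> -` Y) i = carry C Y i" "carry C (\<tau> -` Y) i = carry C Y i"
    "carry (\<tau> -` C) Y i = carry C Y i"
  by (auto intro!: carry_cong simp: tau_other)

lemma set_eqI_tau:
  assumes "i \<in> X \<longleftrightarrow> i \<in> Y" "Suc i \<in> X \<longleftrightarrow> Suc i \<in> Y" "\<And>r. r \<noteq> i \<Longrightarrow> r \<noteq> Suc i \<Longrightarrow> r \<in> X \<longleftrightarrow> r \<in> Y"
  shows "X = Y"
proof (rule set_eqI)
  show "r \<in> X \<longleftrightarrow> r \<in> Y" for r
    using assms(3)[of r] assms(1,2) by (cases "r = i"; cases "r = Suc i") auto
qed

section \<open>Columns containing both or neither of the rows \<open>i\<close> and
  \<open>i + 1\<close>\<close>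

lemma sym_carry:
  assumes "i \<in> C \<longleftrightarrow> Suc i \<in> C"
  shows "carry C (\<tau> -` Y) (Suc (Suc i)) = carry C Y (Suc (Suc i))"
  using assms by (auto simp: carry_Suc carry_tau_i of_bool_def simp del: vimage_eq)

lemma sym_local:
  assumes "i \<in> C \<longleftrightarrow> Suc i \<in> C"
  shows "carry C (\<tau> -` Y) (Suc n) = carry C Y (Suc n)"
    and "r \<noteq> i \<Longrightarrow> r \<noteq> Suc i \<Longrightarrow> r \<in> match_up C (\<tau> -` Y) \<longleftrightarrow> r \<in> match_up C Y"
  by (rule match_up_local; simp add: sym_carry assms)+

text \<open>The order of arrival matters only if exactly one element arrives, both slots exist and
  nobody is waiting; then the slot taken is the one in the row of arrival.\<close>

lemma sym_match_up_cases:
  assumes "i \<in> C \<longleftrightarrow> Suc i \<in> C" "Suc i \<in> Y \<longrightarrow> i \<in> Y"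
  shows "match_up C (\<tau> -` Y) = (if i \<in> C \<and> i \<in> Y \<and> Suc i \<notin> Y \<and> carry C Y i
      = 0 then \<tau> -` match_up C Y else match_up C Y)"
proof (rule set_eqI_tau)
  show "r \<in> match_up C (\<tau> -` Y) \<longleftrightarrow> r \<in> (if i \<in> C \<and> i \<in> Y \<and> Suc i \<notin> Y \<and> carry C Y i
      = 0 then \<tau> -` match_up C Y else match_up C Y)"
    if "r \<noteq> i" "r \<noteq> Suc i" for r
    using sym_local(2)[OF assms(1) that] tau_mem_other[OF that] by (simp split: if_split)
qed (use assms in \<open>auto simp: match_up_def carry_Suc carry_tau_i of_bool_def simp del: vimage_eq\<close>)

lemma sym_match_up_top:
  assumes "i \<in> C \<longleftrightarrow> Suc i \<in> C" "Suc i \<in> Y \<longrightarrow> i \<in> Y" "Suc i \<in> match_up C Y"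
  shows "i \<in> match_up C Y"
  using assms by (auto simp: match_up_def carry_Suc of_bool_def split: if_splits)

text \<open>In these cases either both of the two rows are filled or neither is.\<close>

lemma sym_match_up_tau_invariant:
  assumes "i \<in> C \<longleftrightarrow> Suc i \<in> C" "Suc i \<in> Y \<longrightarrow> i \<in> Y"
      "i \<in> Y \<and> (Suc i \<in> Y \<or> carry C Y i > 0) \<or> i \<notin> Y \<and> carry C Y i = 0"
  shows "\<tau> -` match_up C Y = match_up C Y"
  by (rule sym_tau_vimage) (use assms in \<open>auto simp: match_up_def carry_Suc of_bool_def\<close>)

lemma level_top: "w (Suc i) \<le> w i \<Longrightarrow> Suc i \<in> level w m \<longrightarrow> i \<in> level w m"
  by (auto simp: level_def)

lemma push_col_sym_top:
  assumes "i \<in> C \<longleftrightarrow> Suc i \<in> C" "weak_composition n w" "w (Suc i) \<le> w i"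
  shows "push_col C w (Suc i) \<le> push_col C w i"
proof -
  have "Suc i \<in> level (push_col C w) (Suc m) \<longrightarrow> i \<in> level (push_col C w) (Suc m)" for m
  proof (cases m)
    case 0
    then show ?thesis using assms(1) by simp
  next
    case (Suc k)
    then have "1 \<le> m" by simp
    then show ?thesis
      unfolding level_push_col_Suc[OF assms(2) \<open>1 \<le> m\<close>]
          using sym_match_up_top[OF assms(1) level_top[OF assms(3)]] by blast
  qed
  from this[of "push_col C w (Suc i) - 1"] show ?thesis
      by (cases "push_col C w (Suc i)") (auto simp: level_def)
qed

lemma push_col_sym_dom:
  assumes "i \<in> C \<longleftrightarrow> Suc i \<in> C"
  shows "carry C (level (w \<circ> \<tau>) m) (Suc n) = carry C (level w m) (Suc n)"
  unfolding level_comp by (rule sym_local(1)[OF assms])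

text \<open>Each level is either kept or exchanged. If some level \<open>m0\<close> is exchanged,
  then at every level of the other kind both slots are filled or neither is, so exchanging does not
  affect it and all levels can be treated alike.\<close>

lemma push_col_sym_cases:
  assumes "i \<in> C \<longleftrightarrow> Suc i \<in> C" "weak_composition n w" "w (Suc i) \<le> w i"
  shows "push_col C (w \<circ> \<tau>) = push_col C w \<or> push_col C (w \<circ> \<tau>) = push_col C w \<circ> \<tau>"
proof -
  define B where "B m \<longleftrightarrow> i \<in> C \<and> i \<in> level w m \<and> Suc i \<notin> level w m \<and> carry C (level w m) i = 0" for m
  have match_up: "match_up C (\<tau> -` level w m)
      = (if B m then \<tau> -` match_up C (level w m) else match_up C (level w m))" for m
    unfolding B_def by (rule sym_match_up_cases[OF assms(1) level_top[OF assms(3)]])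
  note L = level_push_col_Suc[OF assms(2)] level_push_col_Suc[OF wc_tau[OF assms(2)]]
  show ?thesis
  proof (cases "\<exists>m\<ge>1. B m")
    case False
    have "push_col C (w \<circ> \<tau>) = push_col C w"
    proof (rule level_eqI)
      fix m
      show "level (push_col C (w \<circ> \<tau>)) (Suc m) = level (push_col C w) (Suc m)"
      proof (cases m)
        case (Suc k)
        then have "1 \<le> m" by simp
        then show ?thesis using L match_up[of m] False by (auto simp: level_comp)
      qed simp
    qed
    then show ?thesis ..
  next
    case True
    then obtain m0 where m0: "1 \<le> m0" "B m0" by blast
    have inv: "\<tau> -` match_up C (level w m) = match_up C (level w m)" if "\<not> B m" for m
    proof (rule sym_match_up_tau_invariant[OF assms(1) level_top[OF assms(3)]])
      have "carry C (level w m) i = 0" if "i \<notin> level w m"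
      proof -
        have "\<not> m \<le> m0" using that m0(2) level_antimono[of m m0 w] by (auto simp: B_def)
        then have "level w m \<subseteq> level w m0" by (intro level_antimono) simp
        then show ?thesis using carry_le_zero m0(2) by (auto simp: B_def)
      qed
      then show "i \<in> level w m \<and> (Suc i \<in> level w m \<or> carry C (level w m) i > 0) \<or> i \<notin> level w m
          \<and> carry C (level w m) i = 0"
        using that m0(2) by (cases "i \<in> level w m") (auto simp: B_def)
    qed
    have "push_col C (w \<circ> \<tau>) = push_col C w \<circ> \<tau>"
    proof (rule level_eqI)
      fix m
      show "level (push_col C (w \<circ> \<tau>)) (Suc m) = level (push_col C w \<circ> \<tau>) (Suc m)"
      proof (cases m)
        case 0
        then show ?thesis by (simp add: level_comp sym_tau_vimage[OF assms(1)])
      next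
        case (Suc k)
        then have "1 \<le> m" by simp
        then show ?thesis using L match_up[of m] inv[of m] by (simp add: level_comp)
      qed
    qed
    then show ?thesis ..
  qed
qed

section \<open>Columns containing exactly one of the rows \<open>i\<close> and
  \<open>i + 1\<close>\<close>

context
  fixes C assumes C: "i \<in> C" "Suc i \<notin> C"
begin

lemma pair_carry:
  assumes "Suc i \<in> Y \<longrightarrow> i \<in> Y"
  shows "carry (\<tau> -` C) Y (Suc (Suc i)) = carry C Y (Suc (Suc i))"
    and "carry (\<tau> -` C) (\<tau> -` Y) (Suc (Suc i)) = carry C Y (Suc (Suc i))"
  using assms C by (auto simp: carry_Suc carry_tau_i of_bool_def simp del: vimage_eq)

lemma pair_local:
  assumes "Suc i \<in> Y \<longrightarrow> i \<in> Y"
  shows "carry (\<tau> -` C) Y (Suc n) = carry C Y (Suc n)"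
    and "carry (\<tau> -` C) (\<tau> -` Y) (Suc n) = carry C Y (Suc n)"
    and "r \<noteq> i \<Longrightarrow> r \<noteq> Suc i \<Longrightarrow> r \<in> match_up (\<tau> -` C) Y \<longleftrightarrow> r \<in> match_up C Y"
    and "r \<noteq> i \<Longrightarrow> r \<noteq> Suc i \<Longrightarrow> r \<in> match_up (\<tau> -` C) (\<tau> -` Y) \<longleftrightarrow> r \<in> match_up C Y"
  by (rule match_up_local; simp add: pair_carry assms)+

text \<open>With one slot in the two rows, what counts is whether somebody has arrived by then. As
  \<open>i \<in> Y\<close> whenever \<open>Suc i \<in> Y\<close>, the answer can differ only for the
  slot at \<open>i\<close> with the exchanged \<open>Y\<close>, the combination absent here.\<close>

lemma pair_match_up:
  assumes Y: "Suc i \<in> Y \<longrightarrow> i \<in> Y"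
  shows "match_up (\<tau> -` C) Y = \<tau> -` match_up C Y" and
      "match_up (\<tau> -` C) (\<tau> -` Y) = \<tau> -` match_up C Y"
proof -
  show "match_up (\<tau> -` C) Y = \<tau> -` match_up C Y"
  proof (rule set_eqI_tau)
    show "r \<in> match_up (\<tau> -` C) Y \<longleftrightarrow> r \<in> \<tau> -` match_up C Y" if "r \<noteq> i" "r \<noteq> Suc i" for r
      using pair_local(3)[OF Y that] tau_mem_other[OF that] by simp
  qed (use Y C in \<open>auto simp: match_up_def carry_Suc carry_tau_i of_bool_def simp del: vimage_eq\<close>)
  show "match_up (\<tau> -` C) (\<tau> -` Y) = \<tau> -` match_up C Y"
  proof (rule set_eqI_tau)
    show "r \<in> match_up (\<tau> -` C) (\<tau> -` Y) \<longleftrightarrow> r \<in> \<tau> -` match_up C Y" if "r \<noteq> i" "r \<noteq> Suc i" for r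
      using pair_local(4)[OF Y that] tau_mem_other[OF that] by simp
  qed (use Y C in \<open>auto simp: match_up_def carry_Suc carry_tau_i of_bool_def simp del: vimage_eq\<close>)
qed

lemma push_col_pair_dom:
  assumes "w (Suc i) \<le> w i"
  shows "carry (\<tau> -` C) (level w m) (Suc n) = carry C (level w m) (Suc n)"
    and "carry (\<tau> -` C) (level (w \<circ> \<tau>) m) (Suc n) = carry C (level w m) (Suc n)"
  unfolding level_comp by (rule pair_local[OF level_top[OF assms]])+

lemma push_col_pair:
  assumes "weak_composition n w" "w (Suc i) \<le> w i"
  shows "push_col (\<tau> -` C) w = push_col C w \<circ> \<tau>" and "push_col (\<tau> -` C) (w \<circ> \<tau>) = push_col C w \<circ> \<tau>"
proof -
  note L = level_push_col_Suc[OF assms(1)] level_push_col_Suc[OF wc_tau[OF assms(1)]]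
  note P = pair_match_up[OF level_top[OF assms(2)]]
  have "level (push_col (\<tau> -` C) w) (Suc m) = level (push_col C w \<circ> \<tau>) (Suc m) \<and>
     level (push_col (\<tau> -` C) (w \<circ> \<tau>)) (Suc m) = level (push_col C w \<circ> \<tau>) (Suc m)" for m
  proof (cases m)
    case (Suc k)
    then have "1 \<le> m" by simp
    then show ?thesis using L P[of m] by (simp add: level_comp)
  qed (simp add: level_comp)
  then show "push_col (\<tau> -` C) w = push_col C w \<circ> \<tau>" "push_col (\<tau> -` C) (w \<circ> \<tau>) = push_col C w \<circ> \<tau>"
    by (auto intro: level_eqI)
qed

lemma push_col_pair_less:
  "push_col C w (Suc i) < push_col C w i" "push_col (\<tau> -` C) w i < push_col (\<tau> -` C) w (Suc i)"
  using C by (auto simp: push_col_def)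

end

end

subsection \<open>The Demazure relation\<close>

context adjacent_swap
begin

definition sym_fun :: "((nat \<Rightarrow> nat) \<Rightarrow> real) \<Rightarrow> (nat \<Rightarrow> nat) \<Rightarrow> real" where
  "sym_fun g w = g (top_comp w)"

definition top_fun :: "((nat \<Rightarrow> nat) \<Rightarrow> real) \<Rightarrow> (nat \<Rightarrow> nat) \<Rightarrow> real" where
  "top_fun g w = (if w i < w (Suc i) then 0 else g w)"

lemma top_comp_tau:
  assumes "w (Suc i) \<le> w i"
  shows "top_comp (w \<circ> \<tau>) = w"
proof (cases "w (Suc i) = w i")
  case True
  then have "w (\<tau> r) = w r" for r by (cases "r = i"; cases "r = Suc i") auto
  then have "w \<circ> \<tau> = w" by auto
  with True show ?thesis by (simp add: top_comp_def)
next
  case False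
  then show ?thesis using assms by (simp add: top_comp_def)
qed

lemma top_comp_top: "w (Suc i) \<le> w i \<Longrightarrow> top_comp w = w"
  by (simp add: top_comp_def)

lemma top_cases:
  assumes "weak_composition n w"
  obtains "w (Suc i) \<le> w i"
  | v where "w = v \<circ> \<tau>" "v (Suc i) < v i" "weak_composition n v"
proof (cases "w (Suc i) \<le> w i")
  case False
  then have "w = (w \<circ> \<tau>) \<circ> \<tau>" "(w \<circ> \<tau>) (Suc i) < (w \<circ> \<tau>) i" by auto
  then show ?thesis using that(2)[of "w \<circ> \<tau>"] wc_tau[OF assms] by blast
qed (use that in blast)

lemma prod_tau:
  assumes "finite C"
  shows "(\<Prod>r\<in>C. (x \<circ> \<tau>) r) = (\<Prod>r\<in>\<tau> -` C. (x :: nat \<Rightarrow> real) r)"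
  by (rule prod.reindex_bij_witness[of _ \<tau> \<tau>]) auto

text \<open>The contribution of the diagrams with first column \<open>C\<close>.\<close>

definition summand :: "nat \<Rightarrow> ((nat \<Rightarrow> nat) \<Rightarrow> real) \<Rightarrow> nat set \<Rightarrow> (nat \<Rightarrow> real) \<Rightarrow> real" where
  "summand M g C x = (\<Prod>r\<in>C. x r) *
     thread_sum n M (\<lambda>w. if carry C (level w 1) (Suc n) = 0 then g (push_col C w) else 0) x"

text \<open>The contribution of first column \<open>C\<close> to the difference of the two sides of
  the Demazure relation; what has to vanish is its sum over all \<open>C\<close>.\<close>

definition defect :: "nat \<Rightarrow> ((nat \<Rightarrow> nat) \<Rightarrow> real) \<Rightarrow> (nat \<Rightarrow> real) \<Rightarrow> nat set \<Rightarrow> real" where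
  "defect M g x C = (x i - x (Suc i)) * summand M (sym_fun g) C x - x i * summand M (top_fun g) C x
     + x (Suc i) * summand M (top_fun g) C (x \<circ> \<tau>)"

text \<open>
  The isobaric divided difference \<open>\<pi>\<^sub>i\<close>, with denominators cleared, takes the sum of \<open>top_fun g\<close> to
  that of \<open>sym_fun g\<close>.
\<close>

definition demazure_rel :: "nat \<Rightarrow> bool" where
  "demazure_rel M \<longleftrightarrow> (\<forall>g x. x i \<noteq> x (Suc i) \<longrightarrow>
     (x i - x (Suc i)) * thread_sum n M (sym_fun g) x =
       x i * thread_sum n M (top_fun g) x - x (Suc i) * thread_sum n M (top_fun g) (x \<circ> \<tau>))"

text \<open>The second part follows by applying the relation at \<open>x \<circ> \<tau>\<close>,
  where the factor and the right-hand side both change sign.\<close>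

lemma demazureD:
  assumes "demazure_rel M" "x i \<noteq> x (Suc i)"
  shows "(x i - x (Suc i)) * thread_sum n M (sym_fun g) x =
       x i * thread_sum n M (top_fun g) x - x (Suc i) * thread_sum n M (top_fun g) (x \<circ> \<tau>)"
    and "thread_sum n M (sym_fun g) (x \<circ> \<tau>) = thread_sum n M (sym_fun g) x"
proof -
  show 1: "(x i - x (Suc i)) * thread_sum n M (sym_fun g) x =
       x i * thread_sum n M (top_fun g) x - x (Suc i) * thread_sum n M (top_fun g) (x \<circ> \<tau>)"
    using assms by (simp add: demazure_rel_def)
  have "(x (Suc i) - x i) * thread_sum n M (sym_fun g) (x \<circ> \<tau>) =
       x (Suc i) * thread_sum n M (top_fun g) (x \<circ> \<tau>) - x i * thread_sum n M (top_fun g) x"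
    using assms(1)[unfolded demazure_rel_def, rule_format, of "x \<circ> \<tau>" g] assms(2) by simp
  with 1 have "(x i - x (Suc i)) * thread_sum n M (sym_fun g) (x \<circ> \<tau>)
      = (x i - x (Suc i)) * thread_sum n M (sym_fun g) x"
    by (simp add: algebra_simps)
  then show "thread_sum n M (sym_fun g) (x \<circ> \<tau>) = thread_sum n M (sym_fun g) x"
      using assms(2) by simp
qed

text \<open>Where exchanging the rows has no effect after pushing (\<open>k1\<close>), both sums
  contain the same symmetric function; elsewhere (\<open>k2\<close>) the exchange commutes with
  pushing and the relation is inherited. The monomial of \<open>C\<close> is symmetric.\<close>

lemma defect_sym:
  assumes IH: "demazure_rel M" and x: "x i \<noteq> x (Suc i)" and C: "i \<in> C \<longleftrightarrow> Suc i \<in> C" "finite C"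
  shows "defect M g x C = 0"
proof -
  let ?dom = "\<lambda>w. carry C (level w 1) (Suc n) = 0"
  define k1 where "k1 w = (if ?dom w \<and> push_col C (w \<circ> \<tau>)
      = push_col C w then g (push_col C w) else 0)" for w
  define k2 where "k2 w = (if ?dom w \<and> push_col C (w \<circ> \<tau>) \<noteq> push_col C w then g (push_col C w)
      else 0)" for w
  have dom: "carry C (level (w \<circ> \<tau>) 1) (Suc n) = carry C (level w 1) (Suc n)" for w
    by (rule push_col_sym_dom[OF C(1)])
  have 1: "(if ?dom w then sym_fun g (push_col C w) else 0) = sym_fun k1 w + sym_fun k2 w"
    if "weak_composition n w" for w
    using that
  proof (cases w rule: top_cases)
    case 1
    then show ?thesis
      using push_col_sym_top[OF C(1) that 1] by (simp add: sym_fun_def top_comp_top k1_def k2_def)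
  next
    case (2 v)
    have t: "push_col C v (Suc i) \<le> push_col C v i"
        using push_col_sym_top[OF C(1) 2(3)] 2(2) by simp
    have "top_comp (push_col C (v \<circ> \<tau>)) = push_col C v"
      using push_col_sym_cases[OF C(1) 2(3)] 2(2) top_comp_tau[OF t] top_comp_top[OF t] by auto
    then show ?thesis
      unfolding 2(1) using 2(2) dom[of v] by (simp add: sym_fun_def top_comp_tau k1_def k2_def)
  qed
  have 2: "(if ?dom w then top_fun g (push_col C w) else 0) = sym_fun k1 w + top_fun k2 w"
    if "weak_composition n w" for w
    using that
  proof (cases w rule: top_cases)
    case 1
    then show ?thesis
      using push_col_sym_top[OF C(1) that 1]
          by (simp add: sym_fun_def top_fun_def top_comp_top k1_def k2_def)
  next
    case (2 v)
    have t: "push_col C v (Suc i) \<le> push_col C v i"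
        using push_col_sym_top[OF C(1) 2(3)] 2(2) by simp
    show ?thesis
    proof (cases "push_col C (v \<circ> \<tau>) = push_col C v")
      case True
      then show ?thesis
        unfolding 2(1) using 2(2) dom[of v] t
            by (simp add: sym_fun_def top_fun_def top_comp_tau k1_def)
    next
      case False
      then have e: "push_col C (v \<circ> \<tau>) = push_col C v \<circ> \<tau>"
        using push_col_sym_cases[OF C(1) 2(3)] 2(2) by auto
      have "push_col C v (Suc i) \<noteq> push_col C v i"
      proof
        assume "push_col C v (Suc i) = push_col C v i"
        then have "push_col C v \<circ> \<tau> = push_col C v"
          using top_comp_tau[OF t] by (simp add: top_comp_def)
        then show False using e False by simp
      qed
      then show ?thesis
        unfolding 2(1) using 2(2) dom[of v] t False e
        by (simp add: sym_fun_def top_fun_def top_comp_tau k1_def)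
    qed
  qed
  have p: "(\<Prod>r\<in>C. (x \<circ> \<tau>) r) = (\<Prod>r\<in>C. x r)"
    using prod_tau[OF C(2), of x] sym_tau_vimage[OF C(1)] by simp
  have s1: "summand M (sym_fun g) C y = (\<Prod>r\<in>C. y r) *
      (thread_sum n M (sym_fun k1) y + thread_sum n M (sym_fun k2) y)" for y
    unfolding summand_def using thread_sum_cong[OF 1, where M = M and x = y]
        by (simp add: thread_sum_add)
  have s2: "summand M (top_fun g) C y = (\<Prod>r\<in>C. y r) *
      (thread_sum n M (sym_fun k1) y + thread_sum n M (top_fun k2) y)" for y
    unfolding summand_def using thread_sum_cong[OF 2, where M = M and x = y]
        by (simp add: thread_sum_add)
  show ?thesis
    unfolding defect_def s1 s2 p demazureD(2)[OF IH x]
    using demazureD(1)[OF IH x, of k2] by algebra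
qed

text \<open>\<open>C\<close> contributes \<open>top_fun k\<close> plus \<open>sym_fun l\<close> to
  both sums; its mirror image contributes \<open>sym_fun k\<close> plus \<open>sym_fun l\<close> to
  the first and nothing to the second. The \<open>l\<close> terms cancel by symmetry, the
  \<open>k\<close> terms by the induction hypothesis.\<close>

lemma defect_pair:
  assumes IH: "demazure_rel M" and x: "x i \<noteq> x (Suc i)" and C: "i \<in> C" "Suc i \<notin> C" "finite C"
  shows "defect M g x C + defect M g x (\<tau> -` C) = 0"
proof -
  let ?D = "\<tau> -` C"
  define K where "K w = (if carry C (level w 1) (Suc n) = 0 then g (push_col C w) else 0)" for w
  \<comment> \<open>\<open>k\<close> measures what changes when the exchanged \<open>w\<close> meets
    the slot at \<open>i\<close>, the combination that \<open>push_col_pair\<close> does not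
    cover.\<close>
  define k where "k w = K w - K (w \<circ> \<tau>)" for w
  define l where "l w = K (w \<circ> \<tau>)" for w
  note less = push_col_pair_less[OF C(1,2)]
  have 1: "(if carry C (level w 1) (Suc n) = 0 then sym_fun g (push_col C w) else 0)
      = top_fun k w + sym_fun l w"
    "(if carry C (level w 1) (Suc n) = 0 then top_fun g (push_col C w) else 0)
        = top_fun k w + sym_fun l w" for w
    using less[of w] by (auto simp: sym_fun_def top_fun_def top_comp_def k_def l_def K_def)
  have 2: "(if carry ?D (level w 1) (Suc n) = 0 then sym_fun g (push_col ?D w) else 0)
      = sym_fun k w + sym_fun l w"
    if "weak_composition n w" for w
    using that
  proof (cases w rule: top_cases)
    case 1
    have "top_comp (push_col C w \<circ> \<tau>) = push_col C w"
        by (rule top_comp_tau) (use less(1)[of w] in simp)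
    then show ?thesis
      using push_col_pair_dom(1)[OF C(1,2) 1, of 1] push_col_pair(1)[OF C(1,2) that 1] 1
      by (simp add: sym_fun_def top_comp_top k_def l_def K_def)
  next
    case (2 v)
    then have le: "v (Suc i) \<le> v i" by simp
    have "top_comp (push_col C v \<circ> \<tau>) = push_col C v"
        by (rule top_comp_tau) (use less(1)[of v] in simp)
    then show ?thesis
      unfolding 2(1) using push_col_pair_dom(2)[OF C(1,2) le, of 1]
          push_col_pair(2)[OF C(1,2) 2(3) le] le
      by (simp add: sym_fun_def top_comp_tau k_def l_def K_def)
  qed
  have 3: "(if carry ?D (level w 1) (Suc n) = 0 then top_fun g (push_col ?D w) else 0) = 0" for w
    using less[of w] by (simp add: top_fun_def)
  define y where "y = (\<Prod>r\<in>C - {i}. x r)"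
  have pC: "(\<Prod>r\<in>C. x r) = x i * y"
    unfolding y_def using C by (simp add: prod.remove)
  have D: "?D = insert (Suc i) (C - {i})"
    by (rule set_eqI_tau) (use C in \<open>simp_all del: vimage_eq add: tau_mem_other\<close>)
  have pD: "(\<Prod>r\<in>?D. x r) = x (Suc i) * y"
    unfolding y_def D using C by simp
  have fD: "finite ?D" unfolding D using C by simp
  have pC': "(\<Prod>r\<in>C. (x \<circ> \<tau>) r) = x (Suc i) * y" using prod_tau[OF C(3), of x] pD by simp
  have s1: "summand M (sym_fun g) C z = (\<Prod>r\<in>C. z r) *
      (thread_sum n M (top_fun k) z + thread_sum n M (sym_fun l) z)"
    "summand M (top_fun g) C z = (\<Prod>r\<in>C. z r) *
        (thread_sum n M (top_fun k) z + thread_sum n M (sym_fun l) z)" for z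
    unfolding summand_def 1 thread_sum_add by simp_all
  have s2: "summand M (sym_fun g) ?D z = (\<Prod>r\<in>?D. z r) *
      (thread_sum n M (sym_fun k) z + thread_sum n M (sym_fun l) z)" for z
    unfolding summand_def using thread_sum_cong[OF 2, where M = M and x = z]
        by (simp add: thread_sum_add)
  have s3: "summand M (top_fun g) ?D z = 0" for z
    unfolding summand_def 3 thread_sum_zero by simp
  show ?thesis
    unfolding defect_def s1 s2 s3 pC pD pC' demazureD(2)[OF IH x]
    using demazureD(1)[OF IH x, of k] by algebra
qed

text \<open>Induction on the number of columns, pairing each first column with its mirror image
  under \<open>\<tau>\<close>; summing the paired defects counts every column twice.\<close>

lemma demazure: "demazure_rel M"
proof (induction M)
  case 0
  show ?case
    by (auto simp: demazure_rel_def sym_fun_def top_fun_def top_comp_def algebra_simps)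
next
  case (Suc M)
  show ?case
    unfolding demazure_rel_def
  proof (intro allI impI)
    fix g and x :: "nat \<Rightarrow> real" assume x: "x i \<noteq> x (Suc i)"
    let ?P = "Pow {1..n}"
    have "defect M g x C + defect M g x (\<tau> -` C) = 0" if "C \<in> ?P" for C
    proof -
      have fin: "finite C" "finite (\<tau> -` C)"
        using that tau_vimage_subset[of C] by (auto intro: finite_subset simp del: vimage_eq)
      consider "i \<in> C \<longleftrightarrow> Suc i \<in> C" | "i \<in> C" "Suc i \<notin> C" | "i \<in> \<tau> -` C" "Suc i \<notin> \<tau> -` C"
        by auto
      then show ?thesis
      proof cases
        case 1
        then show ?thesis using defect_sym[OF Suc x 1 fin(1)] sym_tau_vimage[OF 1] by simp
      next
        case 2
        then show ?thesis using defect_pair[OF Suc x _ _ fin(1)] by simp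
      next
        case 3
        then show ?thesis using defect_pair[OF Suc x 3 fin(2)] by (simp add: add.commute)
      qed
    qed
    then have "(\<Sum>C\<in>?P. defect M g x C + defect M g x (\<tau> -` C)) = 0" by (simp add: sum.neutral)
    moreover have "(\<Sum>C\<in>?P. defect M g x (\<tau> -` C)) = (\<Sum>C\<in>?P. defect M g x C)"
      by (rule sum.reindex_bij_witness[of _ "\<lambda>C. \<tau> -` C" "\<lambda>C. \<tau> -` C"])
        (use tau_vimage_subset in \<open>auto simp del: vimage_eq\<close>)
    ultimately have "(\<Sum>C\<in>?P. defect M g x C) = 0" by (simp add: sum.distrib)
    moreover have "thread_sum n (Suc M) h y = (\<Sum>C\<in>?P. summand M h C y)" for h y
      by (simp add: summand_def)
    ultimately show "(x i - x (Suc i)) * thread_sum n (Suc M) (sym_fun g) x =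
       x i * thread_sum n (Suc M) (top_fun g) x
           - x (Suc i) * thread_sum n (Suc M) (top_fun g) (x \<circ> \<tau>)"
      by (simp add: defect_def sum.distrib sum_subtractf sum_distrib_left del: thread_sum.simps)
  qed
qed

end

subsection \<open>Weakly decreasing compositions\<close>

primrec columns_monomial :: "(nat \<Rightarrow> real) \<Rightarrow> nat set list \<Rightarrow> real" where
  "columns_monomial x [] = 1"
| "columns_monomial x (C # T) = (\<Prod>r\<in>C. x r) * columns_monomial x T"

definition column_lists :: "nat \<Rightarrow> nat \<Rightarrow> nat set list set" where
  "column_lists n M = {T. length T = M \<and> valid_columns n T}"

lemma column_lists_0: "column_lists n 0 = {[]}"
  by (auto simp: column_lists_def)

lemma column_lists_Suc:
  "column_lists n (Suc M) = (\<lambda>(C, T). C # T) `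
     {(C, T). C \<subseteq> {1..n} \<and> T \<in> column_lists n M \<and> carry C (level (thread_comp T) 1) (Suc n) = 0}"
  by (force simp: column_lists_def length_Suc_conv)

lemma finite_column_lists: "finite (column_lists n M)"
proof (induction M)
  case (Suc M)
  have "finite (Pow {1..n} \<times> column_lists n M)" using Suc by simp
  then have "finite {(C, T). C \<subseteq> {1..n} \<and> T \<in> column_lists n M
      \<and> carry C (level (thread_comp T) 1) (Suc n) = 0}"
    by (rule rev_finite_subset) auto
  then show ?case unfolding column_lists_Suc by (rule finite_imageI)
qed (simp add: column_lists_0)

lemma thread_sum_eq_sum: "thread_sum n M g x
    = (\<Sum>T\<in>column_lists n M. g (thread_comp T) * columns_monomial x T)"
proof (induction M arbitrary: g)
  case (Suc M)
  let ?S = "{(C, T). C \<subseteq> {1..n} \<and> T \<in> column_lists n M \<and> carry C (level (thread_comp T) 1) (Suc n)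
      = 0}"
  have inj: "inj_on (\<lambda>(C, T). C # T) ?S" by (auto simp: inj_on_def)
  have "thread_sum n (Suc M) g x = (\<Sum>C\<in>Pow {1..n}. \<Sum>T\<in>column_lists n M.
      (if carry C (level (thread_comp T) 1) (Suc n)
          = 0 then g (push_col C (thread_comp T)) * columns_monomial x (C # T) else 0))"
    unfolding thread_sum.simps Suc sum_distrib_left by (intro sum.cong refl) simp
  also have "\<dots> = (\<Sum>(C, T)\<in>Pow {1..n} \<times> column_lists n M.
      (if carry C (level (thread_comp T) 1) (Suc n)
          = 0 then g (push_col C (thread_comp T)) * columns_monomial x (C # T) else 0))"
    by (rule sum.cartesian_product)
  also have "\<dots> = (\<Sum>(C, T)\<in>?S. g (push_col C (thread_comp T)) * columns_monomial x (C # T))"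
    using finite_column_lists by (intro sum.mono_neutral_cong_right) (auto split: if_splits)
  also have "\<dots> = (\<Sum>T\<in>column_lists n (Suc M). g (thread_comp T) * columns_monomial x T)"
    unfolding column_lists_Suc sum.reindex[OF inj] by (intro sum.cong refl) auto
  finally show ?case .
qed (simp add: column_lists_0)

definition ideal_sum :: "nat \<Rightarrow> nat \<Rightarrow> (nat \<Rightarrow> nat) set \<Rightarrow> (nat \<Rightarrow> real) \<Rightarrow> real" where
  "ideal_sum n M L x = thread_sum n M (\<lambda>w. of_bool (w \<in> L)) x"

lemma ideal_sum_eq_sum: "ideal_sum n M L x
    = (\<Sum>T\<in>{T \<in> column_lists n M. thread_comp T \<in> L}. columns_monomial x T)"
  unfolding ideal_sum_def thread_sum_eq_sum using finite_column_lists
  by (intro sum.mono_neutral_cong_right) (auto simp: of_bool_def)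

lemma finite_diagram_of: "valid_columns n T \<Longrightarrow> finite (diagram_of T)"
proof (induction T)
  case (Cons C T)
  have "cons_col C (diagram_of T) \<subseteq> {1} \<times> C \<union> (\<lambda>(c, r). (Suc c, r)) ` diagram_of T"
  proof
    fix p assume p: "p \<in> cons_col C (diagram_of T)"
    obtain c r where "p = (c, r)" by (cases p)
    then show "p \<in> {1} \<times> C \<union> (\<lambda>(c, r). (Suc c, r)) ` diagram_of T"
      using p by (cases c) (auto simp: cons_col_def intro: rev_image_eqI)
  qed
  moreover have "finite C" using Cons.prems finite_subset by auto
  ultimately show ?case using Cons by (auto intro: finite_subset)
qed simp

lemma wt_cons_col:
  assumes "finite D" "\<And>c r. (c, r) \<in> D \<Longrightarrow> 1 \<le> c"
  shows "wt (cons_col C D) r = of_bool (r \<in> C) + wt D r"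
proof -
  have fin: "finite {c. (c, r) \<in> D}"
    by (rule finite_subset[of _ "fst ` D"]) (use assms(1) in \<open>auto simp: image_iff Bex_def\<close>)
  have e: "{c. (c, r) \<in> cons_col C D} = (if r \<in> C then {1} else {}) \<union> Suc ` {c. (c, r) \<in> D}"
  proof (rule set_eqI)
    fix c show "c \<in> {c. (c, r) \<in> cons_col C D}
        \<longleftrightarrow> c \<in> (if r \<in> C then {1} else {}) \<union> Suc ` {c. (c, r) \<in> D}"
      using assms(2)[of 0 r] by (cases c; cases "c - 1") (auto simp: image_iff)
  qed
  have "1 \<notin> Suc ` {c. (c, r) \<in> D}" using assms(2)[of 0 r] by auto
  then show ?thesis
    unfolding wt_def e using fin by (simp add: card_image)
qed

lemma wt_outside: "valid_columns n T \<Longrightarrow> r \<notin> {1..n} \<Longrightarrow> wt (diagram_of T) r = 0"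
proof (induction T)
  case (Cons C T)
  then show ?case using wt_cons_col[OF finite_diagram_of, of n T C r] diagram_of_pos by auto
qed (simp add: wt_def)

lemma columns_monomial_eq: "valid_columns n T
    \<Longrightarrow> columns_monomial x T = (\<Prod>r\<in>{1..n}. x r ^ wt (diagram_of T) r)"
proof (induction T)
  case Nil
  then show ?case by (simp add: wt_def)
next
  case (Cons C T)
  have w: "wt (diagram_of (C # T)) r = of_bool (r \<in> C) + wt (diagram_of T) r" for r
    using wt_cons_col[OF finite_diagram_of, of n T C r] diagram_of_pos Cons.prems by auto
  have "(\<Prod>r\<in>C. x r) = (\<Prod>r\<in>{1..n}. x r ^ of_bool (r \<in> C))"
    using Cons.prems by (intro prod.mono_neutral_cong_left) auto
  then show ?case
    using Cons unfolding w power_add prod.distrib by simp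
qed

lemma wt_key_diagram: "a 0 = 0 \<Longrightarrow> wt (key_diagram a) r = a r"
proof -
  assume "a 0 = 0"
  then have "{c. (c, r) \<in> key_diagram a} = {1..a r}"
    by (cases r) (auto simp: key_diagram_def)
  then show ?thesis by (simp add: wt_def)
qed

lemma columns_monomial_key_columns:
  assumes "weak_composition n a" "\<And>r. a r \<le> M"
  shows "columns_monomial x (key_columns M a) = (\<Prod>r\<in>{1..n}. x r ^ a r)"
  using columns_monomial_eq[of n "key_columns M a" x] thread_comp_key_columns[OF assms]
      diagram_of_key_columns[of a M] wc_0[OF assms(1)] assms(2)
    wt_key_diagram[of a] by simp

section \<open>Initial segments and diagrams forced by their threads\<close>

definition initial :: "nat set \<Rightarrow> bool" where
  "initial S \<longleftrightarrow> (\<exists>h. S = {1..h})"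

lemma count_below_card: "Y \<subseteq> {1..n} \<Longrightarrow> count_below Y (Suc n) = card Y"
proof -
  assume "Y \<subseteq> {1..n}"
  then have "{..<Suc n} \<inter> {i. i \<in> Y} = Y" by auto
  then show ?thesis unfolding count_below_def by (simp add: sum_of_bool_eq del: sum.lessThan_Suc)
qed

lemma count_below_total_subset:
  assumes "count_below Y (Suc n) \<le> count_below Y (Suc h)" "Y \<subseteq> {1..n}"
  shows "Y \<subseteq> {1..h}"
proof
  fix r assume r: "r \<in> Y"
  have "r \<le> h"
  proof (rule ccontr)
    assume "\<not> r \<le> h"
    then have "count_below Y (Suc h) \<le> count_below Y r" by (intro count_below_mono) simp
    also have "\<dots> < count_below Y (Suc r)" using r by (simp add: count_below_Suc)
    also have "\<dots> \<le> count_below Y (Suc n)" using r assms(2) by (intro count_below_mono) auto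
    finally show False using assms(1) by simp
  qed
  then show "r \<in> {1..h}" using r assms(2) by auto
qed

lemma initial_max:
  assumes "X \<subseteq> {1..h}" "h \<le> n" "Y \<subseteq> {1..n}" "\<And>t. count_below X t \<le> count_below Y t"
      "count_below X (Suc n) = count_below Y (Suc n)"
  shows "Y \<subseteq> {1..h}"
proof (rule count_below_total_subset[OF _ assms(3)])
  show "count_below Y (Suc n) \<le> count_below Y (Suc h)"
    using count_below_const[OF assms(1), of "Suc n"] assms(2) assms(4)[of "Suc h"] assms(5) by simp
qed

text \<open>An initial segment is already as low as possible, so a set of the same size that lies at
  least as low coincides with it.\<close>

lemma initial_eq:
  assumes "initial X" "X \<subseteq> {1..n}" "Y \<subseteq> {1..n}" "\<And>t. count_below X t \<le> count_below Y t"
      "count_below X (Suc n) = count_below Y (Suc n)"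
  shows "Y = X"
proof -
  obtain h where h: "X = {1..h}" using assms(1) by (auto simp: initial_def)
  have "Y \<subseteq> {1..h}"
  proof (cases "h \<le> n")
    case True
    show ?thesis by (rule initial_max[OF _ True assms(3-5)]) (simp add: h)
  next
    case False
    then show ?thesis using assms(3) by force
  qed
  moreover have "card Y = card X" using assms(5) count_below_card[OF assms(2)]
      count_below_card[OF assms(3)] by simp
  ultimately show ?thesis unfolding h by (intro card_subset_eq) auto
qed

text \<open>No matching moves anything: if \<open>C\<close> is initial, threads matched upwards into
  it already lie in it; if column 1 is the exceptional one, the matched images are initial, and only
  an initial set itself can be matched upwards onto it. The exceptional \<open>q\<close>
  accommodates the added box.\<close>

lemma thread_comp_determines:
  assumes "valid_columns n T" "\<And>m. 1 \<le> m \<Longrightarrow> m \<noteq> q \<Longrightarrow> initial (level (thread_comp T) m)"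
  shows "T = key_columns (length T) (thread_comp T)"
  using assms
proof (induction T arbitrary: q)
  case (Cons C T)
  let ?w = "thread_comp T"
  have v: "C \<subseteq> {1..n}" "valid_columns n T" "carry C (level ?w 1) (Suc n) = 0"
      using Cons.prems by auto
  note wc = thread_comp_wc[OF v(2)]
  have fixed: "match_up C (level ?w m) = level ?w m" if m: "1 \<le> m" for m
  proof -
    have sub: "level ?w m \<subseteq> {1..n}" using level_wc[OF wc m] .
    have z: "carry C (level ?w m) (Suc n) = 0"
      using carry_le_zero[OF level_antimono[OF m] v(3)] .
    have muC: "match_up C (level ?w m) \<subseteq> {1..n}" using match_up_subset v(1) by blast
    show ?thesis
    proof (cases "q = 1")
      case True
      then have "initial (match_up C (level ?w m))"
        using Cons.prems(2)[of "Suc m"] m level_push_col_Suc[OF wc m] by simp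
      then show ?thesis
        using initial_eq[OF _ muC sub count_below_match_up_le] count_below_match_up_total[OF z]
            by metis
    next
      case False
      then have "initial C" using Cons.prems(2)[of 1] by simp
      then obtain h where h: "C = {1..h}" by (auto simp: initial_def)
      have "level ?w m \<subseteq> C"
      proof (cases "h \<le> n")
        case True
        show ?thesis
          unfolding h
        proof (rule initial_max[OF _ True sub])
          show "match_up {1..h} (level ?w m) \<subseteq> {1..h}" by (rule match_up_subset)
        qed (use count_below_match_up_le count_below_match_up_total[OF z] h in auto)
      qed (use sub h in force)
      then show ?thesis by (rule match_up_id)
    qed
  qed
  have w: "?w = (\<lambda>r. push_col C ?w r - 1)"
  proof (rule level_eqI)
    show "level ?w (Suc m) = level (\<lambda>r. push_col C ?w r - 1) (Suc m)" for m
      using level_minus_1[of "Suc m" "push_col C ?w"] level_push_col_Suc[OF wc, of "Suc m" C]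
          fixed[of "Suc m"] by simp
  qed
  have "T = key_columns (length T) ?w"
  \<comment> \<open>Removing the first column shifts the exception to \<open>q - 1\<close>; the
    value 0 means that none is left, as levels start at 1.\<close>
  proof (rule Cons.IH[OF v(2), of "q - 1"])
    fix m assume m: "1 \<le> m" "m \<noteq> q - 1"
    then show "initial (level ?w m)"
      using Cons.prems(2)[of "Suc m"] level_push_col_Suc[OF wc m(1), of C] fixed[OF m(1)] by auto
  qed
  then show ?case using w by simp
qed simp

lemma column_lists_single:
  assumes "weak_composition n d" "\<And>r. d r \<le> M" "\<And>m. 1 \<le> m \<Longrightarrow> m \<noteq> q \<Longrightarrow> initial (level d m)"
  shows "{T \<in> column_lists n M. thread_comp T = d} = {key_columns M d}"
proof -
  have "T = key_columns (length T) d" if "valid_columns n T" "thread_comp T = d" for T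
    using thread_comp_determines[OF that(1), of q] that(2) assms(3) by simp
  then show ?thesis using thread_comp_key_columns[OF assms(1,2)]
      unfolding column_lists_def by fastforce
qed

lemma initial_level:
  assumes "weak_composition n a" "\<And>i. 1 \<le> i \<Longrightarrow> Suc i \<le> n \<Longrightarrow> a (Suc i) \<le> a i" "1 \<le> m"
  shows "initial (level a m)"
proof -
  have dec: "a j \<le> a i" if "1 \<le> i" "i \<le> j" for i j
    using that(2)
  proof (induction rule: dec_induct)
    case (step u)
    have "a (Suc u) \<le> a u"
    proof (cases "Suc u \<le> n")
      case False
      then have "a (Suc u) = 0" using assms(1) by (simp add: weak_composition_def)
      then show ?thesis by simp
    qed (use assms(2) step that(1) in auto)
    then show ?case using step by simp
  qed simp
  have sub: "level a m \<subseteq> {1..n}" using level_wc[OF assms(1,3)] .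
  then have fin: "finite (level a m)" by (rule finite_subset) simp
  show ?thesis
  proof (cases "level a m = {}")
    case True
    then show ?thesis by (auto simp: initial_def intro: exI[of _ 0])
  next
    case False
    have mx: "m \<le> a (Max (level a m))" using Max_in[OF fin False] by (simp add: level_def)
    have "r \<in> level a m" if "1 \<le> r" "r \<le> Max (level a m)" for r
      using order.trans[OF mx dec[OF that]] by (simp add: level_def)
    then have "level a m = {1..Max (level a m)}"
      using Max_ge[OF fin] sub by auto
    then show ?thesis unfolding initial_def by blast
  qed
qed

context
  fixes n a
  assumes wca: "weak_composition n a" and dec: "\<And>i. 1 \<le> i \<Longrightarrow> Suc i \<le> n \<Longrightarrow> a (Suc i) \<le> a i"
begin

lemma below_decreasing:
  assumes "weak_composition n d" "below n d a"
  shows "d = a"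
proof (rule level_eqI)
  fix m
  show "level d (Suc m) = level a (Suc m)"
  proof (rule initial_eq[OF initial_level[OF wca dec] level_wc[OF wca] level_wc[OF assms(1)]])
  qed (use assms(2) in \<open>auto simp: below_def\<close>)
qed

text \<open>All levels except \<open>q\<close> agree with those of \<open>a\<close> by
  \<open>initial_eq\<close>. Level \<open>q\<close> is an initial segment plus one element
  \<open>j\<close>; the inequality at \<open>Suc k\<close> gives \<open>j \<le> k\<close>, and
  nestedness of the levels gives \<open>Suc (a j) = q\<close>.\<close>

lemma box_below_decreasing:
  assumes wd: "weak_composition n d" and q: "1 \<le> q" and cr: "box_below n a k q d" and k: "k \<le> n"
  shows "\<exists>j\<in>{1..k}. d = a + unit_comp j"
proof -
  have eq: "level d m = level a m" if "1 \<le> m" "m \<noteq> q" for m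
  proof (rule initial_eq[OF initial_level[OF wca dec that(1)] level_wc[OF wca that(1)]
      level_wc[OF wd that(1)]])
  qed (use cr that in \<open>auto simp: box_below_def\<close>)
  obtain h where h: "level a q = {1..h}"
      using initial_level[OF wca dec q] by (auto simp: initial_def)
  have sa: "level a q \<subseteq> {1..n}" and sd: "level d q \<subseteq> {1..n}" using level_wc q wca wd by auto
  have A: "count_below (level a q) t + of_bool (k < t) \<le> count_below (level d q) t" for t
    using cr[unfolded box_below_def, rule_format, OF q] by simp
  have tot: "count_below (level a q) (Suc n) + 1 = count_below (level d q) (Suc n)"
    using cr[unfolded box_below_def, rule_format, OF q] by simp
  have ca: "count_below (level a q) (Suc h) = h" unfolding h
      using count_below_card[of "{1..h}" h] by simp
  have "card (level d q \<inter> {1..h}) \<le> card {1..h}" by (intro card_mono) auto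
  moreover have cd: "count_below (level d q) (Suc h) = card (level d q \<inter> {1..h})"
  proof -
    have "count_below (level d q) (Suc h) = count_below (level d q \<inter> {1..h}) (Suc h)"
      by (rule count_below_cong) (use sd in auto)
    then show ?thesis using count_below_card[of "level d q \<inter> {1..h}" h] by simp
  qed
  moreover have "h \<le> count_below (level d q) (Suc h)" using A[of "Suc h"] ca by simp
  ultimately have dh: "count_below (level d q) (Suc h) = h" and
      "card (level d q \<inter> {1..h}) = card {1..h}"
    by simp_all
  then have full: "level d q \<inter> {1..h} = {1..h}" by (intro card_subset_eq) auto
  have "h < count_below (level d q) (Suc n)"
    using tot ca count_below_card[OF sa] unfolding h by simp
  then obtain j where j: "Suc h \<le> j" "j < Suc n" "j \<in> level d q"
    using count_below_less_ex[of "level d q" "Suc h" "Suc n"] dh by auto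
  have lq: "level d q = insert j {1..h}"
  proof (rule card_subset_eq[symmetric])
    show "finite (level d q)" using sd finite_subset by blast
    show "insert j {1..h} \<subseteq> level d q" using full j by blast
    have "card (level d q) = h + 1" using tot count_below_card[OF sa] count_below_card[OF sd]
        unfolding h by simp
    then show "card (insert j {1..h}) = card (level d q)" using j by simp
  qed
  have "j \<le> k"
  proof (rule ccontr)
    assume "\<not> j \<le> k"
    then have "count_below (level d q) (Suc k) = count_below (level a q) (Suc k)"
      unfolding lq h by (intro count_below_cong) auto
    then show False using A[of "Suc k"] by simp
  qed
  have aj: "Suc (a j) = q"
  proof -
    have "j \<notin> level a q" using h j(1) by simp
    then have "\<not> q \<le> a j" by (simp add: level_def)
    moreover have "q - 1 \<le> a j"
    proof (cases "q = 1")
      case False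
      then have q': "1 \<le> q - 1" "q - 1 \<noteq> q" using q by auto
      have "j \<in> level d (q - 1)" using j(3) level_antimono[OF diff_le_self] by blast
      then have "j \<in> level a (q - 1)" unfolding eq[OF q'] .
      then show ?thesis by (simp add: level_def)
    qed simp
    ultimately show ?thesis using q by simp
  qed
  have "d = a + unit_comp j"
  proof (rule level_eqI)
    fix m
    have l: "level (a + unit_comp j) (Suc m)
        = (if Suc m = q then insert j (level a q) else level a (Suc m))"
      using aj by (auto simp: level_def unit_comp_def)
    show "level d (Suc m) = level (a + unit_comp j) (Suc m)"
      unfolding l using eq[of "Suc m"] lq h by auto
  qed
  then show ?thesis using j \<open>j \<le> k\<close> by auto
qed

lemma box_ideal_decreasing:
  assumes "k \<le> n"
  shows "box_ideal n a k = (\<lambda>j. a + unit_comp j) ` {1..k}"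
proof (intro equalityI subsetI)
  fix d assume "d \<in> box_ideal n a k"
  then show "d \<in> (\<lambda>j. a + unit_comp j) ` {1..k}"
    using box_below_decreasing assms unfolding box_ideal_def by blast
next
  fix d assume "d \<in> (\<lambda>j. a + unit_comp j) ` {1..k}"
  then obtain j where j: "1 \<le> j" "j \<le> k" "d = a + unit_comp j" by auto
  have "box_below n a k (Suc (a j)) d" by (rule below_imp_box_below[of n a a]) (use j assms in auto)
  moreover have "weak_composition n d" using wc_plus_unit[OF wca j(1)] j assms by auto
  ultimately show "d \<in> box_ideal n a k" by (auto simp: box_ideal_def)
qed

lemma ideal_sum_decreasing_single:
  assumes "\<And>r. a r \<le> M" "1 \<le> j" "j \<le> n"
  shows "{T \<in> column_lists n (Suc M). thread_comp T = a + unit_comp j}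
      = {key_columns (Suc M) (a + unit_comp j)}"
proof -
  let ?d = "a + unit_comp j"
  have wd: "weak_composition n ?d" using wc_plus_unit[OF wca assms(2,3)] .
  have b: "?d r \<le> Suc M" for r using assms(1)[of r] by (auto simp: unit_comp_def)
  have "initial (level ?d m)" if "1 \<le> m" "m \<noteq> Suc (a j)" for m
  proof -
    have "level ?d m = level a m" using that(2) by (auto simp: level_def unit_comp_def)
    then show ?thesis using initial_level[OF wca dec that(1)] by simp
  qed
  then show ?thesis by (rule column_lists_single[OF wd b])
qed

lemma ideal_sum_below_decreasing:
  assumes "\<And>r. a r \<le> M"
  shows "ideal_sum n M {d. weak_composition n d \<and> below n d a} x = (\<Prod>r\<in>{1..n}. x r ^ a r)"
proof -
  have "{T \<in> column_lists n M. thread_comp T = a} = {key_columns M a}"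
    by (rule column_lists_single[OF wca assms initial_level[OF wca dec]])
  moreover have "thread_comp T \<in> {d. weak_composition n d \<and> below n d a} \<longleftrightarrow> thread_comp T = a" for T
    using below_decreasing wca by auto
  ultimately have "{T \<in> column_lists n M. thread_comp T \<in> {d. weak_composition n d \<and> below n d a}}
      = {key_columns M a}" by simp
  then show ?thesis unfolding ideal_sum_eq_sum
      using columns_monomial_key_columns[OF wca assms] by simp
qed

text \<open>Both sides are explicit: only the key diagram of \<open>a\<close> has \<theta> below
  \<open>a\<close>, and each \<open>a + unit_comp j\<close> admits a single diagram, whose monomial
  is \<open>x j\<close> times that of \<open>a\<close>.\<close>

lemma monk_decreasing:
  assumes "\<And>r. a r \<le> M" "k \<le> n"
  shows "(\<Sum>j\<in>{1..k}. x j) * ideal_sum n (Suc M) {d. weak_composition n d \<and> below n d a} x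
      = ideal_sum n (Suc M) (box_ideal n a k) x"
proof -
  have "a r \<le> Suc M" for r using assms(1)[of r] by simp
  note 1 = ideal_sum_below_decreasing[OF this, of x]
  have inj: "inj_on (\<lambda>j. key_columns (Suc M) (a + unit_comp j)) {1..k}"
  proof (rule inj_onI)
    fix j l assume j: "j \<in> {1..k}" and l: "l \<in> {1..k}"
      and e: "key_columns (Suc M) (a + unit_comp j) = key_columns (Suc M) (a + unit_comp l)"
    have "thread_comp (key_columns (Suc M) (a + unit_comp i)) = a + unit_comp i"
        if "i \<in> {1..k}" for i
    proof -
      have "(a + unit_comp i) r \<le> Suc M" for r using assms(1)[of r] by (auto simp: unit_comp_def)
      then show ?thesis
        using thread_comp_key_columns[OF wc_plus_unit[OF wca, of i], of "Suc M"] that assms(2)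
            by (auto simp del: key_columns.simps)
    qed
    then have "a + unit_comp j = a + unit_comp l" using e j l by metis
    then have "unit_comp j = unit_comp l" by simp
    then have "unit_comp j j = unit_comp l j" by simp
    then show "j = l" by (simp add: unit_comp_def split: if_splits)
  qed
  have "{T \<in> column_lists n (Suc M). thread_comp T \<in> box_ideal n a k}
      = (\<Union>j\<in>{1..k}. {T \<in> column_lists n (Suc M). thread_comp T = a + unit_comp j})"
    unfolding box_ideal_decreasing[OF assms(2)] by auto
  also have "\<dots> = (\<lambda>j. key_columns (Suc M) (a + unit_comp j)) ` {1..k}"
    using ideal_sum_decreasing_single[OF assms(1)] assms(2) by auto
  finally have "ideal_sum n (Suc M) (box_ideal n a k) x
      = (\<Sum>j\<in>{1..k}. columns_monomial x (key_columns (Suc M) (a + unit_comp j)))"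
    unfolding ideal_sum_eq_sum by (simp only: sum.reindex[OF inj] o_def)
  also have "\<dots> = (\<Sum>j\<in>{1..k}. x j * (\<Prod>r\<in>{1..n}. x r ^ a r))"
  proof (rule sum.cong[OF refl])
    fix j assume j: "j \<in> {1..k}"
    have "columns_monomial x (key_columns (Suc M) (a + unit_comp j))
        = (\<Prod>r\<in>{1..n}. x r ^ (a + unit_comp j) r)"
    proof (rule columns_monomial_key_columns)
      show "weak_composition n (a + unit_comp j)"
          using wc_plus_unit[OF wca, of j] j assms(2) by simp
      show "(a + unit_comp j) r \<le> Suc M" for r using assms(1)[of r] by (auto simp: unit_comp_def)
    qed
    also have "\<dots> = (\<Prod>r\<in>{1..n}. x r ^ a r) * (\<Prod>r\<in>{1..n}. if r = j then x r else 1)"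
      unfolding prod.distrib[symmetric] by (intro prod.cong refl) (auto simp: unit_comp_def)
    also have "(\<Prod>r\<in>{1..n}. if r = j then x r else 1) = x j"
      using j assms(2) by (simp add: prod.delta)
    finally show "columns_monomial x (key_columns (Suc M) (a + unit_comp j))
        = x j * (\<Prod>r\<in>{1..n}. x r ^ a r)"
      by (simp only: mult.commute)
  qed
  finally show ?thesis unfolding 1 by (simp add: sum_distrib_right)
qed

end

subsection \<open>Adding a box and adjacent transpositions\<close>

lemma box_below_0: "box_below n a k 0 d \<longleftrightarrow> below n d a"
  unfolding box_below_def below_def by auto

lemma ideal_sum_cong:
  assumes "\<And>w. weak_composition n w \<Longrightarrow> w \<in> L \<longleftrightarrow> w \<in> L'"
  shows "ideal_sum n M L x = ideal_sum n M L' x"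
  unfolding ideal_sum_def by (rule thread_sum_cong) (use assms in simp)

definition swap_ideal :: "nat \<Rightarrow> (nat \<Rightarrow> nat) \<Rightarrow> (nat \<Rightarrow> nat) set" where
  "swap_ideal n a = {d. weak_composition n d \<and> below n d a}"

context adjacent_swap
begin

text \<open>The part of \<open>L\<close> that is strictly increasing at \<open>i\<close> has
  indicator \<open>sym_fun h - top_fun h\<close>, which the divided difference kills; what is left
  is \<open>top_fun g\<close>, to which the Demazure relation applies.\<close>

lemma demazure_ideal_sum:
  assumes "x i \<noteq> x (Suc i)"
  shows "(x i - x (Suc i)) * ideal_sum n M {d. top_comp d \<in> L} x
      = x i * ideal_sum n M L x - x (Suc i) * ideal_sum n M L (x \<circ> \<tau>)"
proof -
  define g h :: "(nat \<Rightarrow> nat) \<Rightarrow> real" where "g w = of_bool (w \<in> L)" and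
      "h w = of_bool (w \<circ> \<tau> \<in> L \<and> w (Suc i) < w i)" for w
  have 1: "ideal_sum n M {d. top_comp d \<in> L} x = thread_sum n M (sym_fun g) x"
    unfolding ideal_sum_def by (rule thread_sum_cong) (simp add: sym_fun_def g_def)
  have "of_bool (w \<in> L) = top_fun g w + (sym_fun h w - top_fun h w)" for w
    by (auto simp: top_fun_def sym_fun_def top_comp_def g_def h_def)
  then have "ideal_sum n M L y = thread_sum n M (\<lambda>w. top_fun g w + (sym_fun h w - top_fun h w)) y"
      for y
    unfolding ideal_sum_def by (intro thread_sum_cong)
  then have 2: "ideal_sum n M L y = thread_sum n M (top_fun g) y
      + (thread_sum n M (sym_fun h) y - thread_sum n M (top_fun h) y)" for y
    by (simp add: thread_sum_add thread_sum_diff)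
  show ?thesis
    unfolding 1 2 demazureD(2)[OF demazure assms]
    using demazureD(1)[OF demazure assms, where g = g and M = M]
        demazureD(1)[OF demazure assms, where g = h and M = M]
    by algebra
qed

lemma count_below_level_tau:
  assumes "t \<noteq> Suc i"
  shows "count_below (level (a \<circ> \<tau>) m) t = count_below (level a m) t"
proof -
  have low: "count_below (level (a \<circ> \<tau>) m) i = count_below (level a m) i"
    unfolding level_comp by (rule count_below_cong) simp
  show ?thesis
  proof (cases "t \<le> i")
    case True
    then show ?thesis unfolding level_comp by (intro count_below_cong) simp
  next
    case False
    then have "Suc (Suc i) \<le> t" using assms by simp
    then have "count_below (level (a \<circ> \<tau>) m) t + count_below (level a m) (Suc (Suc i))
        = count_below (level a m) t + count_below (level (a \<circ> \<tau>) m) (Suc (Suc i))"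
      by (rule count_below_interval_cong) (simp add: level_def)
    moreover have "count_below (level (a \<circ> \<tau>) m) (Suc (Suc i))
        = count_below (level a m) (Suc (Suc i))"
      using low by (simp add: count_below_Suc level_def)
    ultimately show ?thesis by simp
  qed
qed

text \<open>The inequalities at \<open>t = Suc i\<close> are left out, since only these see the
  order of the rows \<open>i\<close> and \<open>Suc i\<close>; the rest is invariant under
  \<open>\<tau>\<close> in \<open>a\<close> and in \<open>d\<close>.\<close>

definition box_below_away :: "(nat \<Rightarrow> nat) \<Rightarrow> nat \<Rightarrow> nat \<Rightarrow> (nat \<Rightarrow> nat) \<Rightarrow> bool" where
  "box_below_away a k q d \<longleftrightarrow> (\<forall>m\<ge>1.
     (\<forall>t. t \<noteq> Suc i \<longrightarrow> count_below (level a m) t + of_bool (m = q \<and> k < t)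
         \<le> count_below (level d m) t) \<and>
     count_below (level a m) (Suc n) + of_bool (m = q) = count_below (level d m) (Suc n))"

lemma Suc_n_neq: "Suc n \<noteq> Suc i"
  using i by simp

lemma box_below_away_tau [simp]: "box_below_away (a \<circ> \<tau>) k q d \<longleftrightarrow> box_below_away a k q d"
    "box_below_away a k q (d \<circ> \<tau>) \<longleftrightarrow> box_below_away a k q d"
  unfolding box_below_away_def by (simp_all add: count_below_level_tau
      count_below_level_tau[OF Suc_n_neq])

lemma box_below_split:
  "box_below n a k q d \<longleftrightarrow> box_below_away a k q d \<and> (\<forall>m\<ge>1.
     count_below (level a m) i + of_bool (m \<le> a i) + of_bool (m = q \<and> k \<le> i)
         \<le> count_below (level d m) i + of_bool (m \<le> d i))"
proof -
  have "count_below (level a m) (Suc i) + of_bool (m = q \<and> k < Suc i)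
      \<le> count_below (level d m) (Suc i) \<longleftrightarrow>
     count_below (level a m) i + of_bool (m \<le> a i) + of_bool (m = q \<and> k \<le> i)
         \<le> count_below (level d m) i + of_bool (m \<le> d i)" for m
    by (simp add: count_below_Suc level_def less_Suc_eq_le)
  then show ?thesis unfolding box_below_def box_below_away_def by (metis (no_types, lifting))
qed

lemma box_below_tau:
  "box_below n (a \<circ> \<tau>) k q d \<longleftrightarrow> box_below_away a k q d \<and> (\<forall>m\<ge>1.
     count_below (level a m) i + of_bool (m \<le> a (Suc i)) + of_bool (m = q \<and> k \<le> i)
         \<le> count_below (level d m) i + of_bool (m \<le> d i))"
  unfolding box_below_split box_below_away_tau using count_below_level_tau[of i] by simp

lemma box_below_top:
  "box_below n a k q (top_comp d) \<longleftrightarrow> box_below_away a k q d \<and> (\<forall>m\<ge>1.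
     count_below (level a m) i + of_bool (m \<le> a i) + of_bool (m = q \<and> k \<le> i)
       \<le> count_below (level d m) i + of_bool (m \<le> max (d i) (d (Suc i))))"
  unfolding box_below_split using count_below_level_tau[of i] by (simp add: top_comp_def max_def)

lemma box_below_away_below:
  assumes "box_below_away a k q d" "1 \<le> m"
  shows "count_below (level a m) i + of_bool (m = q \<and> k < i) \<le> count_below (level d m) i"
  using assms unfolding box_below_away_def by (metis n_not_Suc_n)

lemma box_below_away_above:
  assumes "box_below_away a k q d" "1 \<le> m"
  shows "count_below (level a m) i + of_bool (m \<le> a i) + of_bool (m \<le> a (Suc i))
      + of_bool (m = q \<and> k \<le> Suc i)
    \<le> count_below (level d m) i + of_bool (m \<le> d i) + of_bool (m \<le> d (Suc i))"
proof -
  have "count_below (level a m) (Suc (Suc i)) + of_bool (m = q \<and> k < Suc (Suc i))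
      \<le> count_below (level d m) (Suc (Suc i))"
    using assms unfolding box_below_away_def by (metis n_not_Suc_n)
  then show ?thesis by (simp add: count_below_Suc level_def less_Suc_eq_le)
qed

text \<open>For \<open>k \<noteq> i\<close> both sides amount to \<open>box_below_away\<close>: the
  inequality at \<open>Suc i\<close> follows from its neighbours at \<open>i\<close> and
  \<open>Suc (Suc i)\<close>.\<close>

lemma box_below_tau_top:
  assumes "a (Suc i) < a i" "k \<noteq> i"
  shows "box_below n (a \<circ> \<tau>) k q d \<longleftrightarrow> box_below n a k q (top_comp d)"
proof -
  have "count_below (level a m) i + of_bool (m \<le> a (Suc i)) + of_bool (m = q \<and> k \<le> i)
      \<le> count_below (level d m) i + of_bool (m \<le> d i) \<and>
    count_below (level a m) i + of_bool (m \<le> a i) + of_bool (m = q \<and> k \<le> i)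
       \<le> count_below (level d m) i + of_bool (m \<le> max (d i) (d (Suc i)))"
    if "box_below_away a k q d" "1 \<le> m" for m
    using box_below_away_below[OF that] box_below_away_above[OF that] assms
        by (auto simp: of_bool_def max_def split: if_splits)
  then show ?thesis unfolding box_below_tau box_below_top by blast
qed

lemma swap_ideal_tau:
  assumes "a (Suc i) < a i" "weak_composition n d"
  shows "d \<in> swap_ideal n (a \<circ> \<tau>) \<longleftrightarrow> top_comp d \<in> swap_ideal n a"
  \<comment> \<open>\<open>q = 0\<close> means no box, so any \<open>k \<noteq> i\<close> may be
    inserted.\<close>
  using box_below_tau_top[OF assms(1), of "Suc i" 0 d] assms(2) wc_tau[OF assms(2)]
  by (auto simp: box_below_0 swap_ideal_def top_comp_def)

lemma box_ideal_tau:
  assumes "a (Suc i) < a i" "weak_composition n d" "k \<noteq> i"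
  shows "d \<in> box_ideal n (a \<circ> \<tau>) k \<longleftrightarrow> top_comp d \<in> box_ideal n a k"
  using box_below_tau_top[OF assms(1,3)] assms(2) wc_tau[OF assms(2)]
  by (auto simp: box_ideal_def top_comp_def)

text \<open>Lowering \<open>k\<close> from \<open>i\<close> to \<open>i - 1\<close> affects only the
  inequality at \<open>t = i\<close>.\<close>

lemma box_below_away_pred: "box_below_away a (i - 1) q d
    \<longleftrightarrow> box_below_away a i q d \<and> (1 \<le> q \<longrightarrow> count_below (level a q) i + 1 \<le> count_below (level d q) i)"
proof
  assume r: "box_below_away a (i - 1) q d"
  have "of_bool (m = q \<and> i < t) \<le> (of_bool (m = q \<and> i - 1 < t) :: nat)" for m t by auto
  then have "box_below_away a i q d" using r
      unfolding box_below_away_def by (meson add_left_mono order.trans)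
  moreover have "count_below (level a q) i + 1 \<le> count_below (level d q) i" if "1 \<le> q"
      using box_below_away_below[OF r that] i by simp
  ultimately show "box_below_away a i q d
      \<and> (1 \<le> q \<longrightarrow> count_below (level a q) i + 1 \<le> count_below (level d q) i)" by blast
next
  assume r: "box_below_away a i q d \<and> (1 \<le> q
      \<longrightarrow> count_below (level a q) i + 1 \<le> count_below (level d q) i)"
  have "count_below (level a m) t + of_bool (m = q \<and> i - 1 < t) \<le> count_below (level d m) t"
      if "1 \<le> m" "t \<noteq> Suc i" for m t
  proof (cases "t = i")
    case True
    then show ?thesis using r that box_below_away_below[of a i q d m] by auto
  next
    case False
    then have "i - 1 < t \<longleftrightarrow> i < t" using that(2) by auto
    then show ?thesis using r that unfolding box_below_away_def by simp
  qed
  then show "box_below_away a (i - 1) q d" using r unfolding box_below_away_def by blast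
qed

lemma box_below_away_Suc: "box_below_away a (Suc i) q d \<longleftrightarrow> box_below_away a i q d"
proof -
  have "t \<noteq> Suc i \<Longrightarrow> Suc i < t \<longleftrightarrow> i < t" for t by auto
  then show ?thesis unfolding box_below_away_def by simp
qed

text \<open>Given \<open>box_below_away\<close>, \<open>S''\<close> always holds. If
  \<open>A q < D q\<close>, then so does \<open>St\<close>, and the other terms cancel. Otherwise
  the terms with \<open>i - 1\<close> vanish, and the rest is inclusion-exclusion for
  \<open>a i < q\<close> and \<open>q \<le> d i\<close>, at least one of which is true.\<close>

lemma box_below_identity:
  assumes lt: "a (Suc i) < a i" and q: "1 \<le> q"
  shows "of_bool (box_below n (a \<circ> \<tau>) i q d) + of_bool (box_below n a i q (top_comp d))
      + of_bool (box_below n a (i - 1) q d)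
    = (of_bool (box_below n (a \<circ> \<tau>) (Suc i) q d) + of_bool (box_below n (a \<circ> \<tau>) (i - 1) q d)
        + of_bool (box_below n a i q d) :: real)"
proof (cases "box_below_away a i q d")
  case False
  then show ?thesis
    unfolding box_below_tau box_below_top
        unfolding box_below_split box_below_away_pred box_below_away_Suc by simp
next
  case r: True
  define A D where "A m = count_below (level a m) i" and "D m = count_below (level d m) i" for m
  have lo: "A m \<le> D m" if "1 \<le> m" for m
    using box_below_away_below[OF r that] by (simp add: A_def D_def)
  have hi: "A m + of_bool (m \<le> a i) + of_bool (m \<le> a (Suc i)) + of_bool (m = q)
      \<le> D m + of_bool (m \<le> d i) + of_bool (m \<le> d (Suc i))" if "1 \<le> m" for m
    using box_below_away_above[OF r that] by (simp add: A_def D_def)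
  define S' St S S'' where
    "S' \<longleftrightarrow> (\<forall>m\<ge>1. A m + of_bool (m \<le> a (Suc i)) + of_bool (m = q) \<le> D m + of_bool (m \<le> d i))" and
    "St \<longleftrightarrow> (\<forall>m\<ge>1. A m + of_bool (m \<le> a i) + of_bool (m = q)
        \<le> D m + of_bool (m \<le> max (d i) (d (Suc i))))" and
    "S \<longleftrightarrow> (\<forall>m\<ge>1. A m + of_bool (m \<le> a i) + of_bool (m = q) \<le> D m + of_bool (m \<le> d i))" and
    "S'' \<longleftrightarrow> (\<forall>m\<ge>1. A m + of_bool (m \<le> a (Suc i)) \<le> D m + of_bool (m \<le> d i))"
  have e: "box_below n (a \<circ> \<tau>) i q d \<longleftrightarrow> S'" "box_below n a i q (top_comp d) \<longleftrightarrow> St"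
    "box_below n a (i - 1) q d \<longleftrightarrow> A q + 1 \<le> D q \<and> S" "box_below n (a \<circ> \<tau>) (Suc i) q d \<longleftrightarrow> S''"
    "box_below n (a \<circ> \<tau>) (i - 1) q d \<longleftrightarrow> A q + 1 \<le> D q \<and> S'" "box_below n a i q d \<longleftrightarrow> S"
    unfolding box_below_tau box_below_top
        unfolding box_below_split box_below_away_pred box_below_away_Suc
    using r q by (simp_all add: A_def D_def S'_def St_def S_def S''_def)
  have S'': S''
    unfolding S''_def
  proof (intro allI impI)
    fix m :: nat assume m: "1 \<le> m"
    show "A m + of_bool (m \<le> a (Suc i)) \<le> D m + of_bool (m \<le> d i)"
      using lo[OF m] hi[OF m] lt by (auto simp: of_bool_def split: if_splits)
  qed
  show ?thesis
  proof (cases "A q + 1 \<le> D q")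
    case True
    have St
      unfolding St_def
    proof (intro allI impI)
      fix m :: nat assume m: "1 \<le> m"
      show "A m + of_bool (m \<le> a i) + of_bool (m = q) \<le> D m + of_bool (m \<le> max (d i) (d (Suc i)))"
        using lo[OF m] hi[OF m] lt True by (auto simp: of_bool_def max_def split: if_splits)
    qed
    then show ?thesis unfolding e using S'' True by simp
  next
    case False
    then have Dq: "D q = A q" using lo[OF q] by simp
    have St: "St \<longleftrightarrow> a i < q"
    proof
      assume St
      then have "A q + of_bool (q \<le> a i) + of_bool (q = q)
          \<le> D q + of_bool (q \<le> max (d i) (d (Suc i)))"
        using q unfolding St_def by blast
      then show "a i < q" using Dq by (auto simp: of_bool_def split: if_splits)
    next
      assume less: "a i < q"
      show St
        unfolding St_def
      proof (intro allI impI)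
        fix m :: nat assume m: "1 \<le> m"
        show "A m + of_bool (m \<le> a i) + of_bool (m = q) \<le> D m + of_bool (m \<le> max (d i) (d (Suc i)))"
          using lo[OF m] hi[OF m] lt less Dq hi[OF q]
              by (auto simp: of_bool_def max_def split: if_splits)
      qed
    qed
    have S': "S' \<longleftrightarrow> q \<le> d i"
    proof
      assume S'
      then have "A q + of_bool (q \<le> a (Suc i)) + of_bool (q = q) \<le> D q + of_bool (q \<le> d i)"
        using q unfolding S'_def by blast
      then show "q \<le> d i" using Dq by (auto simp: of_bool_def split: if_splits)
    next
      assume less: "q \<le> d i"
      show S'
        unfolding S'_def
      proof (intro allI impI)
        fix m :: nat assume m: "1 \<le> m"
        show "A m + of_bool (m \<le> a (Suc i)) + of_bool (m = q) \<le> D m + of_bool (m \<le> d i)"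
          using lo[OF m] hi[OF m] lt less Dq hi[OF q] by (auto simp: of_bool_def split: if_splits)
      qed
    qed
    have S: "S \<longleftrightarrow> a i < q \<and> q \<le> d i"
    proof
      assume S
      then have "A q + of_bool (q \<le> a i) + of_bool (q = q) \<le> D q + of_bool (q \<le> d i)"
        using q unfolding S_def by blast
      then show "a i < q \<and> q \<le> d i" using Dq by (auto simp: of_bool_def split: if_splits)
    next
      assume less: "a i < q \<and> q \<le> d i"
      show S
        unfolding S_def
      proof (intro allI impI)
        fix m :: nat assume m: "1 \<le> m"
        show "A m + of_bool (m \<le> a i) + of_bool (m = q) \<le> D m + of_bool (m \<le> d i)"
          using lo[OF m] hi[OF m] lt less Dq hi[OF q] by (auto simp: of_bool_def split: if_splits)
      qed
    qed
    have "q \<le> d i" if "q \<le> a i" using hi[OF q] Dq that by (auto simp: of_bool_def split: if_splits)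
    then show ?thesis unfolding e S' S St using S'' False by auto
  qed
qed

text \<open>The column \<open>q\<close> is the only one where the totals of \<open>a\<close> and
  \<open>d\<close> differ, so all six memberships refer to the same \<open>q\<close>.\<close>

lemma box_ideal_identity:
  assumes lt: "a (Suc i) < a i" and wd: "weak_composition n d"
  shows "of_bool (d \<in> box_ideal n (a \<circ> \<tau>) i) + of_bool (top_comp d \<in> box_ideal n a i)
      + of_bool (d \<in> box_ideal n a (i - 1))
    = (of_bool (d \<in> box_ideal n (a \<circ> \<tau>) (Suc i)) + of_bool (d \<in> box_ideal n (a \<circ> \<tau>) (i - 1))
        + of_bool (d \<in> box_ideal n a i) :: real)"
proof -
  define Q where "Q q \<longleftrightarrow> 1 \<le> q \<and> (\<forall>m\<ge>1. count_below (level a m) (Suc n) + of_bool (m = q)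
      = count_below (level d m) (Suc n))" for q
  have wt: "weak_composition n (top_comp d)" using wd wc_tau by (simp add: top_comp_def)
  have Q: "Q q" if "box_below_away a k q d" "1 \<le> q" for k q
    using that unfolding box_below_away_def Q_def by blast
  have uniq: "q = q'" if "Q q" "Q q'" for q q'
  proof -
    have "count_below (level a q) (Suc n) + of_bool (q = q) = count_below (level d q) (Suc n)"
      "count_below (level a q) (Suc n) + of_bool (q = q') = count_below (level d q) (Suc n)"
      using that unfolding Q_def by blast+
    then show ?thesis by (auto simp: of_bool_def split: if_splits)
  qed
  show ?thesis
  proof (cases "\<exists>q. Q q")
    case False
    then have no: "\<not> box_below_away a k q d" if "1 \<le> q" for k q using Q[OF _ that] by blast
    have "\<not> box_below n (a \<circ> \<tau>) k q d" "\<not> box_below n a k q (top_comp d)" "\<not> box_below n a k q d"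
        if "1 \<le> q" for k q
      using no[OF that] box_below_tau box_below_top box_below_split[of a k q d] by blast+
    then have "d \<notin> box_ideal n (a \<circ> \<tau>) k" "top_comp d \<notin> box_ideal n a k" "d \<notin> box_ideal n a k" for k
      unfolding box_ideal_def by blast+
    then show ?thesis by simp
  next
    case True
    then obtain q where q: "Q q" by blast
    then have q1: "1 \<le> q" by (simp add: Q_def)
    have only: "(\<exists>q'\<ge>1. box_below_away a k q' d \<and> R q') \<longleftrightarrow> box_below_away a k q d \<and> R q" for k R
      using Q uniq[OF q] q1 by blast
    have m: "d \<in> box_ideal n (a \<circ> \<tau>) k \<longleftrightarrow> box_below n (a \<circ> \<tau>) k q d"
        "d \<in> box_ideal n a k \<longleftrightarrow> box_below n a k q d"
      "top_comp d \<in> box_ideal n a k \<longleftrightarrow> box_below n a k q (top_comp d)" for k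
    proof -
      have "(\<exists>q'\<ge>1. box_below n (a \<circ> \<tau>) k q' d) \<longleftrightarrow> box_below n (a \<circ> \<tau>) k q d"
          unfolding box_below_tau by (rule only)
      then show "d \<in> box_ideal n (a \<circ> \<tau>) k \<longleftrightarrow> box_below n (a \<circ> \<tau>) k q d" unfolding box_ideal_def
          using wd by simp
      have "(\<exists>q'\<ge>1. box_below n a k q' d) \<longleftrightarrow> box_below n a k q d"
          unfolding box_below_split by (rule only)
      then show "d \<in> box_ideal n a k \<longleftrightarrow> box_below n a k q d" unfolding box_ideal_def using wd by simp
      have "(\<exists>q'\<ge>1. box_below n a k q' (top_comp d)) \<longleftrightarrow> box_below n a k q (top_comp d)"
          unfolding box_below_top by (rule only)
      then show "top_comp d \<in> box_ideal n a k \<longleftrightarrow> box_below n a k q (top_comp d)"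
          unfolding box_ideal_def using wt by simp
    qed
    show ?thesis unfolding m by (rule box_below_identity[OF lt q1])
  qed
qed

lemma ideal_sum_identity:
  assumes "a (Suc i) < a i"
  shows "ideal_sum n M (box_ideal n (a \<circ> \<tau>) i) x
      + ideal_sum n M {d. top_comp d \<in> box_ideal n a i} x + ideal_sum n M (box_ideal n a (i - 1)) x
    = ideal_sum n M (box_ideal n (a \<circ> \<tau>) (Suc i)) x
        + ideal_sum n M (box_ideal n (a \<circ> \<tau>) (i - 1)) x + ideal_sum n M (box_ideal n a i) x"
  unfolding ideal_sum_def thread_sum_add[symmetric]
      by (rule thread_sum_cong) (use box_ideal_identity[OF assms] in simp)

lemma sum_tau:
  assumes "k \<noteq> i"
  shows "(\<Sum>j\<in>{1..k}. (x \<circ> \<tau>) j) = (\<Sum>j\<in>{1..k}. (x :: nat \<Rightarrow> real) j)"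
proof (cases "k < i")
  case True
  then show ?thesis by (intro sum.cong) auto
next
  case False
  then have "Suc i \<le> k" using assms by simp
  then show ?thesis
    by (intro sum.reindex_bij_witness[of _ \<tau> \<tau>]) (use i in \<open>auto simp: transpose_def\<close>)
qed

text \<open>For \<open>k \<noteq> i\<close> the sum of the variables is invariant under
  \<open>\<tau>\<close> and passes through the divided difference. For \<open>k = i\<close> the
  cases \<open>Suc i\<close> and \<open>i - 1\<close>, settled first, enter the linear relation. The
  hypothesis covers \<open>x \<circ> \<tau>\<close> because the divided difference evaluates
  there.\<close>

lemma monk_step:
  fixes x :: "nat \<Rightarrow> real"
  assumes lt: "a (Suc i) < a i" and x: "x i \<noteq> x (Suc i)" and k: "k \<le> n"
    and IH: "\<And>k y. k \<le> n \<Longrightarrow> y \<in> {x, x \<circ> \<tau>}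
        \<Longrightarrow> (\<Sum>j\<in>{1..k}. y j) * ideal_sum n M (swap_ideal n a) y = ideal_sum n M (box_ideal n a k) y"
  shows "(\<Sum>j\<in>{1..k}. x j) * ideal_sum n M (swap_ideal n (a \<circ> \<tau>)) x
      = ideal_sum n M (box_ideal n (a \<circ> \<tau>) k) x"
proof -
  let ?F = "ideal_sum n M (swap_ideal n a)" and ?F' = "ideal_sum n M (swap_ideal n (a \<circ> \<tau>))"
  have F': "(x i - x (Suc i)) * ?F' x = x i * ?F x - x (Suc i) * ?F (x \<circ> \<tau>)"
    unfolding demazure_ideal_sum[OF x, symmetric]
    by (intro arg_cong2[where f = "(*)"] refl ideal_sum_cong) (use swap_ideal_tau[OF lt] in simp)
  have ne: "(\<Sum>j\<in>{1..k}. x j) * ?F' x = ideal_sum n M (box_ideal n (a \<circ> \<tau>) k) x"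
      if k: "k \<noteq> i" "k \<le> n" for k
  proof -
    let ?s = "\<Sum>j\<in>{1..k}. x j"
    have "(x i - x (Suc i)) * ideal_sum n M (box_ideal n (a \<circ> \<tau>) k) x =
        x i * ideal_sum n M (box_ideal n a k) x
            - x (Suc i) * ideal_sum n M (box_ideal n a k) (x \<circ> \<tau>)"
      unfolding demazure_ideal_sum[OF x, symmetric]
      by (intro arg_cong2[where f = "(*)"] refl ideal_sum_cong)
          (use box_ideal_tau[OF lt _ k(1)] in simp)
    also have "\<dots> = ?s * (x i * ?F x - x (Suc i) * ?F (x \<circ> \<tau>))"
      using IH[OF k(2), of x] IH[OF k(2), of "x \<circ> \<tau>"] unfolding sum_tau[OF k(1)]
      by (simp add: algebra_simps)
    also have "\<dots> = (x i - x (Suc i)) * (?s * ?F' x)" unfolding F'[symmetric] by simp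
    finally show ?thesis using x by simp
  qed
  show ?thesis
  proof (cases "k = i")
    case False
    then show ?thesis using ne k by simp
  next
    case True
    let ?s = "\<Sum>j\<in>{1..i - 1}. x j" and ?P = "ideal_sum n M (box_ideal n (a \<circ> \<tau>) i) x" and ?T
        = "ideal_sum n M {d. top_comp d \<in> box_ideal n a i} x"
    have si: "(\<Sum>j\<in>{1..i}. y j) = (\<Sum>j\<in>{1..i - 1}. y j) + y i" for y :: "nat \<Rightarrow> real"
      using i by (cases i) simp_all
    have sS: "(\<Sum>j\<in>{1..Suc i}. x j) = ?s + x i + x (Suc i)" using si[of x] by simp
    have si': "(\<Sum>j\<in>{1..i}. (x \<circ> \<tau>) j) = ?s + x (Suc i)"
      unfolding si sum_tau[of "i - 1", OF less_imp_neq[OF diff_less]]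
          using sum_tau[of "i - 1" x] i by simp
    have T: "(x i - x (Suc i)) * ?T = x i * ((?s + x i) * ?F x)
        - x (Suc i) * ((?s + x (Suc i)) * ?F (x \<circ> \<tau>))"
      unfolding demazure_ideal_sum[OF x]
          using IH[of i x] IH[of i "x \<circ> \<tau>"] i unfolding si' si[of x] by simp
    have "?P + ?T + ?s * ?F x = (?s + x i + x (Suc i)) * ?F' x + ?s * ?F' x + (?s + x i) * ?F x"
      using ideal_sum_identity[OF lt, of M x] IH[of "i - 1" x] IH[of i x] ne[of "Suc i"]
          ne[of "i - 1"] i
      unfolding sS si[of x] by simp
    then have "(x i - x (Suc i)) * ((?s + x i) * ?F' x) = (x i - x (Suc i)) * ?P"
      using T F' by algebra
    then show ?thesis unfolding True si[of x] using x by simp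
  qed
qed

end

text \<open>Induction towards weakly decreasing \<open>a\<close>: \<open>\<tau>\<close> removes an
  ascent, and \<open>monk_step\<close> leads back. Injectivity of \<open>x\<close> yields the
  distinct values needed for division and survives composition with \<open>\<tau>\<close>.\<close>

lemma monk_ideal_sum:
  assumes "weak_composition n a" "\<And>r. a r \<le> M" "k \<le> n" "inj x"
  shows "(\<Sum>j\<in>{1..k}. x j) * ideal_sum n (Suc M) (swap_ideal n a) x
      = ideal_sum n (Suc M) (box_ideal n a k) x"
  using assms
proof (induction "\<Sum>r\<le>n. r * a r" arbitrary: a k x rule: less_induct)
  case less
  show ?case
  proof (cases "\<exists>i\<ge>1. Suc i \<le> n \<and> a i < a (Suc i)")
    case False
    then have "a (Suc i) \<le> a i" if "1 \<le> i" "Suc i \<le> n" for i using that not_less by blast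
    from monk_decreasing[OF less.prems(1) this less.prems(2,3)] show ?thesis
      unfolding swap_ideal_def by simp
  next
    case True
    then obtain i where ascent: "1 \<le> i" "Suc i \<le> n" "a i < a (Suc i)" by blast
    interpret adjacent_swap n i by unfold_locales (use ascent in auto)
    have e: "a \<circ> \<tau> = a(i := a (Suc i), Suc i := a i)"
      by (auto simp: transpose_def)
    have "(\<Sum>r\<le>n. r * (a \<circ> \<tau>) r) < (\<Sum>r\<le>n. r * a r)"
      unfolding e using sum_swap[of i "Suc i" n "\<lambda>r. r" a, OF lessI ascent(2)]
        rearrangement_less[of i "Suc i" "a i" "a (Suc i)", OF lessI ascent(3)] by linarith
    then have "(\<Sum>j\<in>{1..l}. y j) * ideal_sum n (Suc M) (swap_ideal n (a \<circ> \<tau>)) y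
        = ideal_sum n (Suc M) (box_ideal n (a \<circ> \<tau>) l) y"
      if "l \<le> n" "y \<in> {x, x \<circ> \<tau>}" for l y
    proof (rule less.hyps[OF _ wc_tau[OF less.prems(1)] _ that(1)])
      show "inj y" using that(2) less.prems(4) by (auto intro: inj_compose)
    qed (use less.prems(2) in auto)
    moreover have "(a \<circ> \<tau>) (Suc i) < (a \<circ> \<tau>) i" using ascent by simp
    moreover have "x i \<noteq> x (Suc i)" using less.prems(4) by (auto dest: injD)
    ultimately show ?thesis
      using monk_step[of "a \<circ> \<tau>" x k "Suc M"] less.prems(3) by simp
  qed
qed

subsection \<open>From generating functions to bijections\<close>

lemma digits_less:
  fixes w :: "nat \<Rightarrow> nat"
  assumes "\<And>r. w r < B"
  shows "(\<Sum>r\<in>{1..n}. w r * B ^ r) < B ^ Suc n"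
proof (induction n)
  case 0
  show ?case using assms[of 0] by simp
next
  case (Suc n)
  have "w (Suc n) * B ^ Suc n + B ^ Suc n = Suc (w (Suc n)) * B ^ Suc n" by simp
  also have "\<dots> \<le> B * B ^ Suc n" using assms[of "Suc n"] by (intro mult_right_mono) auto
  finally show ?case using Suc by simp
qed

lemma digits_inject:
  fixes v w :: "nat \<Rightarrow> nat"
  assumes "\<And>r. v r < B" "\<And>r. w r < B"
    and "(\<Sum>r\<in>{1..n}. v r * B ^ r) = (\<Sum>r\<in>{1..n}. w r * B ^ r)" "r \<in> {1..n}"
  shows "v r = w r"
  using assms(3,4)
proof (induction n)
  case (Suc n)
  let ?V = "\<Sum>r\<in>{1..n}. v r * B ^ r" and ?W = "\<Sum>r\<in>{1..n}. w r * B ^ r" and ?P = "B ^ Suc n"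
  have P: "0 < ?P" using assms(1)[of 0] by simp
  have e: "?V + v (Suc n) * ?P = ?W + w (Suc n) * ?P" using Suc.prems(1) by simp
  note l = digits_less[of v B n, OF assms(1)] digits_less[of w B n, OF assms(2)]
  have "v (Suc n) = w (Suc n)"
    using arg_cong[OF e, of "\<lambda>z. z div ?P"] l P by simp
  then show ?case using e Suc by (cases "r = Suc n") auto
qed simp

text \<open>Bijections between corresponding fibres are chosen and glued.\<close>

lemma bij_betw_of_card_fibres:
  assumes "finite A" "finite B" "\<And>e. card {a \<in> A. K a = e} = card {b \<in> B. L b = e}"
  shows "\<exists>f. bij_betw f A B \<and> (\<forall>a\<in>A. L (f a) = K a)"
proof -
  have "\<exists>h. bij_betw h {a \<in> A. K a = e} {b \<in> B. L b = e}" for e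
    using assms by (intro finite_same_card_bij) auto
  then obtain h where h: "\<And>e. bij_betw (h e) {a \<in> A. K a = e} {b \<in> B. L b = e}" by metis
  define f where "f a = h (K a) a" for a
  have f: "f a \<in> B" "L (f a) = K a" if "a \<in> A" for a
    using bij_betwE[OF h[of "K a"]] that unfolding f_def by auto
  have "inj_on f A"
  proof (rule inj_onI)
    fix a b assume ab: "a \<in> A" "b \<in> A" "f a = f b"
    then have "K a = K b" using f(2) by metis
    then show "a = b"
      using bij_betw_imp_inj_on[OF h[of "K a"]] ab unfolding f_def by (auto dest: inj_onD)
  qed
  moreover have "b \<in> f ` A" if "b \<in> B" for b
  proof -
    have "b \<in> h (L b) ` {a \<in> A. K a = L b}"
      using bij_betw_imp_surj_on[OF h[of "L b"]] that by simp
    then obtain a where "a \<in> A" "K a = L b" "b = h (L b) a" by blast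
    then have "a \<in> A" "b = f a" unfolding f_def by simp_all
    then show ?thesis by blast
  qed
  ultimately show ?thesis using f unfolding bij_betw_def by blast
qed

text \<open>Substituting \<open>x r = t ^ (N ^ r)\<close> with \<open>N\<close> above all exponents
  turns each monomial into a power of \<open>t\<close> whose exponent has the weight as its digits
  in base \<open>N\<close>. The two polynomials agree at infinitely many \<open>t\<close>, so they
  are equal, and their coefficients count the weights.\<close>

lemma weight_bijection:
  fixes u :: "'a \<Rightarrow> nat \<Rightarrow> nat" and v :: "'b \<Rightarrow> nat \<Rightarrow> nat"
  assumes fin: "finite A" "finite B"
    and supp: "\<And>a r. a \<in> A \<Longrightarrow> r \<notin> {1..n} \<Longrightarrow> u a r = 0" "\<And>b r. b \<in> B \<Longrightarrow> r \<notin> {1..n} \<Longrightarrow> v b r = 0"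
    and eq: "\<And>x :: nat \<Rightarrow> real. inj x \<Longrightarrow> (\<Sum>a\<in>A. \<Prod>r\<in>{1..n}. x r ^ u a r)
        = (\<Sum>b\<in>B. \<Prod>r\<in>{1..n}. x r ^ v b r)"
  shows "\<exists>f. bij_betw f A B \<and> (\<forall>a\<in>A. v (f a) = u a)"
proof -
  \<comment> \<open>The summand 2 makes the powers \<open>N ^ r\<close> distinct, so that the
    substitution \<open>x\<close> is injective.\<close>
  define N where "N = 2 + (\<Sum>a\<in>A. \<Sum>r\<in>{1..n}. u a r) + (\<Sum>b\<in>B. \<Sum>r\<in>{1..n}. v b r)"
  have bu: "u a r < N" if "a \<in> A" for a r
  proof (cases "r \<in> {1..n}")
    case True
    have "u a r \<le> (\<Sum>r\<in>{1..n}. u a r)" using True by (intro member_le_sum) auto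
    also have "\<dots> \<le> (\<Sum>a\<in>A. \<Sum>r\<in>{1..n}. u a r)" using that fin by (intro member_le_sum) auto
    finally show ?thesis unfolding N_def by simp
  qed (use supp(1)[OF that] in \<open>simp add: N_def\<close>)
  have bv: "v b r < N" if "b \<in> B" for b r
  proof (cases "r \<in> {1..n}")
    case True
    have "v b r \<le> (\<Sum>r\<in>{1..n}. v b r)" using True by (intro member_le_sum) auto
    also have "\<dots> \<le> (\<Sum>b\<in>B. \<Sum>r\<in>{1..n}. v b r)" using that fin by (intro member_le_sum) auto
    finally show ?thesis unfolding N_def by simp
  qed (use supp(2)[OF that] in \<open>simp add: N_def\<close>)
  define code where "code w = (\<Sum>r\<in>{1..n}. w r * N ^ r)" for w :: "nat \<Rightarrow> nat"
  define p q :: "real poly" where "p = (\<Sum>a\<in>A. monom 1 (code (u a)))" and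
      "q = (\<Sum>b\<in>B. monom 1 (code (v b)))"
  have "poly p (real t) = poly q (real t)" if "2 \<le> t" for t :: nat
  proof -
    define x where "x r = real t ^ (N ^ r)" for r :: nat
    have "inj x"
    proof (rule injI)
      fix r s assume "x r = x s"
      then have "N ^ r = N ^ s" unfolding x_def using that by (simp add: power_inject_exp)
      moreover have "1 < N" unfolding N_def by simp
      ultimately show "r = s" by simp
    qed
    moreover have "(\<Prod>r\<in>{1..n}. x r ^ w r) = real t ^ code w" for w
      unfolding x_def code_def power_sum
          by (intro prod.cong refl) (simp add: power_mult[symmetric] mult.commute)
    ultimately show ?thesis
      using eq[of x] unfolding p_def q_def by (simp add: poly_sum poly_monom)
  qed
  then have "real ` {2..} \<subseteq> {t. poly (p - q) t = 0}" by auto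
  moreover have "infinite (real ` {2::nat..})"
    using finite_imageD[of real "{2::nat..}"] infinite_Ici by (auto simp: inj_on_def)
  ultimately have "infinite {t. poly (p - q) t = 0}" using finite_subset by blast
  then have "p = q" using poly_roots_finite[of "p - q"] by auto
  moreover have "coeff p e = card {a \<in> A. code (u a) = e}"
      "coeff q e = card {b \<in> B. code (v b) = e}" for e
    unfolding p_def q_def using fin
    by (simp_all add: coeff_sum coeff_monom sum.If_cases Int_def conj_commute)
  ultimately have "card {a \<in> A. code (u a) = e} = card {b \<in> B. code (v b) = e}" for e
    by (metis of_nat_eq_iff)
  then obtain f where f: "bij_betw f A B" "\<And>a. a \<in> A \<Longrightarrow> code (v (f a)) = code (u a)"
    using bij_betw_of_card_fibres[OF fin, of "\<lambda>a. code (u a)" "\<lambda>b. code (v b)"] by auto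
  have "v (f a) = u a" if a: "a \<in> A" for a
  proof
    fix r
    have fa: "f a \<in> B" using bij_betwE[OF f(1)] a by blast
    show "v (f a) r = u a r"
    proof (cases "r \<in> {1..n}")
      case True
      show ?thesis
        by (rule digits_inject[OF bv[OF fa] bu[OF a] f(2)[OF a, unfolded code_def] True])
    qed (use supp(1)[OF a] supp(2)[OF fa] in simp)
  qed
  with f(1) show ?thesis by blast
qed

section \<open>The two sides of the bijection as generating functions\<close>

definition diagram_monomial :: "nat \<Rightarrow> (nat \<Rightarrow> real) \<Rightarrow> diagram \<Rightarrow> real" where
  "diagram_monomial n x D = (\<Prod>r\<in>{1..n}. x r ^ wt D r)"

lemma sum_diagram_monomial: "(\<Sum>D\<in>diagram_of ` {T \<in> column_lists n M. thread_comp T \<in> L}.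
    diagram_monomial n x D) = ideal_sum n M L x"
proof -
  have "inj_on diagram_of {T \<in> column_lists n M. thread_comp T \<in> L}"
    using inj_on_diagram_of[of M] by (rule inj_on_subset) (auto simp: column_lists_def)
  then show ?thesis
    unfolding ideal_sum_eq_sum by (subst sum.reindex)
        (auto simp: column_lists_def columns_monomial_eq diagram_monomial_def intro!: sum.cong)
qed

lemma KD_eq_column_lists:
  assumes "weak_composition n a" "\<And>r. a r \<le> M"
  shows "KD a = diagram_of ` {T \<in> column_lists n M. thread_comp T \<in> swap_ideal n a}"
  unfolding KD_eq[OF assms] by (rule arg_cong[where f = "(`) diagram_of"])
      (auto simp: column_lists_def swap_ideal_def thread_comp_wc)

lemma wc_unit: "1 \<le> k \<Longrightarrow> k \<le> n \<Longrightarrow> weak_composition n (unit_comp k)"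
  by (auto simp: weak_composition_def unit_comp_def)

text \<open>\<open>unit_comp k\<close> arises by adding a box to the zero composition; nested levels
  force that box into column 1.\<close>

lemma box_ideal_zero:
  assumes "k \<le> n"
  shows "box_ideal n (\<lambda>_. 0) k = swap_ideal n (unit_comp k)"
proof -
  have u: "count_below (level (unit_comp k) m) t = of_bool (m = 1 \<and> k < t)" if "1 \<le> m" for m t
  proof (induction t)
    case (Suc t)
    then show ?case using that by (cases "t = k")
        (auto simp: count_below_Suc level_def unit_comp_def less_Suc_eq)
  qed simp
  have z: "level (\<lambda>_. 0) m = {}" if "1 \<le> m" for m using that by (auto simp: level_def)
  have 1: "box_below n (\<lambda>_. 0) k 1 d \<longleftrightarrow> below n d (unit_comp k)" for d
    unfolding box_below_def below_def using assms by (auto simp: u z)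
  have "q = 1" if "1 \<le> q" "box_below n (\<lambda>_. 0) k q d" for q d
  proof (rule ccontr)
    assume "q \<noteq> 1"
    have "count_below (level d q) (Suc n) = 1" "count_below (level d 1) (Suc n) = 0"
      using that \<open>q \<noteq> 1\<close> unfolding box_below_def by (auto simp: z)
    then show False using count_below_subset[OF level_antimono[OF that(1)], of d "Suc n"] by simp
  qed
  then show ?thesis using 1 unfolding box_ideal_def swap_ideal_def by (auto intro: exI[of _ 1])
qed

text \<open>The generating function of the second factor is the weakly decreasing case for the zero
  composition.\<close>

lemma sum_diagram_monomial_unit:
  assumes "1 \<le> k" "k \<le> n"
  shows "(\<Sum>D\<in>KD (unit_comp k). diagram_monomial n x D) = (\<Sum>j\<in>{1..k}. x j)"
proof -
  have z: "weak_composition n (\<lambda>_. 0)" by (simp add: weak_composition_def)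
  have "(\<Sum>D\<in>KD (unit_comp k). diagram_monomial n x D)
      = ideal_sum n 1 (swap_ideal n (unit_comp k)) x"
    by (subst KD_eq_column_lists[OF wc_unit[OF assms], of 1])
        (auto simp: unit_comp_def sum_diagram_monomial simp del: One_nat_def)
  also have "\<dots> = (\<Sum>j\<in>{1..k}. x j)"
    using monk_decreasing[OF z, of 0 k x] ideal_sum_below_decreasing[OF z, of 1 x] assms(2)
        box_ideal_zero[OF assms(2)] by simp
  finally show ?thesis .
qed

theorem theorem3p1p4:
  fixes n k :: nat and a :: "nat \<Rightarrow> nat"
  assumes "n \<ge> 1" and "weak_composition n a" and "1 \<le> k" and "k \<le> n"
  shows "\<exists>f :: diagram \<times> diagram \<Rightarrow> diagram.
           bij_betw f (KD a \<times> KD (unit_comp k))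
             (\<Union>b \<in> {b. left_swap_le n b a}. \<Union>j \<in> {1..k}. KD (b + unit_comp j)) \<and>
           (\<forall>S \<in> KD a. \<forall>T \<in> KD (unit_comp k). wt (f (S, T)) = wt S + wt T)"
proof -
  let ?U = "\<Union>b \<in> {b. left_swap_le n b a}. \<Union>j \<in> {1..k}. KD (b + unit_comp j)"
  obtain M where M: "\<And>r. a r \<le> M" using wc_bounded[OF assms(2)] by blast
  \<comment> \<open>Length \<open>Suc M\<close> instead of \<open>M\<close>, so that both sides
    range over the same column lists as in \<open>monk_ideal_sum\<close>.\<close>
  have a: "KD a = diagram_of ` {T \<in> column_lists n (Suc M). thread_comp T \<in> swap_ideal n a}"
    by (rule KD_eq_column_lists[OF assms(2)]) (use M in \<open>simp add: le_SucI\<close>)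
  have e: "KD (unit_comp k) = diagram_of `
      {T \<in> column_lists n 1. thread_comp T \<in> swap_ideal n (unit_comp k)}"
    by (rule KD_eq_column_lists[OF wc_unit[OF assms(3,4)]]) (simp add: unit_comp_def)
  have U: "?U = diagram_of ` {T \<in> column_lists n (Suc M). thread_comp T \<in> box_ideal n a k}"
    unfolding union_KD_eq[OF assms(2) M assms(4)] by (simp add: column_lists_def conj_assoc)
  have fin: "finite (diagram_of ` {T \<in> column_lists n N. thread_comp T \<in> L})" for N L
    using finite_column_lists by simp
  have supp: "wt D r = 0" if "D \<in> diagram_of ` {T \<in> column_lists n N. thread_comp T \<in> L}"
      "r \<notin> {1..n}" for D N L r
    using that wt_outside by (auto simp: column_lists_def)
  have "\<exists>f. bij_betw f (KD a \<times> KD (unit_comp k)) ?U \<and>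
      (\<forall>p\<in>KD a \<times> KD (unit_comp k). wt (f p) = wt (fst p) + wt (snd p))"
  proof (rule weight_bijection)
    show "finite (KD a \<times> KD (unit_comp k))" unfolding a e using fin by blast
    show "finite ?U" unfolding U by (rule fin)
    show "(wt (fst p) + wt (snd p)) r = 0" if "p \<in> KD a \<times> KD (unit_comp k)" "r \<notin> {1..n}" for p r
    proof -
      have "fst p \<in> KD a" "snd p \<in> KD (unit_comp k)" using that(1) by auto
      then have "wt (fst p) r = 0" "wt (snd p) r = 0"
          using supp[OF _ that(2)] unfolding a e by blast+
      then show ?thesis by simp
    qed
    show "wt D r = 0" if "D \<in> ?U" "r \<notin> {1..n}" for D r
      using that(1) unfolding U by (rule supp[OF _ that(2)])
  next
    fix x :: "nat \<Rightarrow> real" assume "inj x"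
    have "(\<Sum>p\<in>KD a \<times> KD (unit_comp k). \<Prod>r\<in>{1..n}. x r ^ (wt (fst p) + wt (snd p)) r)
        = (\<Sum>p\<in>KD a \<times> KD (unit_comp k). diagram_monomial n x (fst p) * diagram_monomial n x (snd p))"
      unfolding diagram_monomial_def prod.distrib[symmetric]
      by (intro sum.cong prod.cong refl) (simp only: plus_fun_apply power_add)
    also have "\<dots> = (\<Sum>S\<in>KD a. diagram_monomial n x S) *
        (\<Sum>T\<in>KD (unit_comp k). diagram_monomial n x T)"
      by (simp only: sum_product sum.cartesian_product case_prod_unfold)
    also have "\<dots> = ideal_sum n (Suc M) (box_ideal n a k) x"
      unfolding sum_diagram_monomial_unit[OF assms(3,4)] a sum_diagram_monomial
      using monk_ideal_sum[OF assms(2) M assms(4) \<open>inj x\<close>] by (simp only: mult.commute)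
    also have "\<dots> = (\<Sum>D\<in>?U. \<Prod>r\<in>{1..n}. x r ^ wt D r)"
      unfolding U sum_diagram_monomial[symmetric] diagram_monomial_def ..
    finally show "(\<Sum>p\<in>KD a \<times> KD (unit_comp k). \<Prod>r\<in>{1..n}. x r ^ (wt (fst p) + wt (snd p)) r)
        = (\<Sum>D\<in>?U. \<Prod>r\<in>{1..n}. x r ^ wt D r)" .
  qed
  then show ?thesis by auto
qed

end
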